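(* Let $G=(\mathbb{V},\mathbb{E})$ be an infinite, connected, undirected, uniformly locally finite graph, and let $V:\mathbb{V}\to\mathbb{R}$ satisfy $\inf_{x\in\mathbb{V}}V(x)>-1$. If $\lim_{d(x,x_0)\to\infty}V(x)=+\infty$ for some $x_0\in\mathbb{V}$, then the equation $$-\Delta u+V(x)u=u\log u^2\quad\text{in }\mathbb{V}$$ has infinitely many solutions $\pm u_n\in X$ ($n\in\mathbb{N}$) such that $\lim_{n\to\infty}J(\pm u_n)=\infty$.
   Context: All functions are real valued. $x\sim y$ means $xy\in\mathbb{E}$; $d(x,y)$ is the minimal number of edges connecting $x$ and $y$. Uniformly locally finite means there is a constant $C$ with $\#\{y:y\sim x\}\le C$ for all $x\in\mathbb{V}$. Edge weights are $1$, $\mu$ is the counting measure, and $\int_{\mathbb{V}}f\,d\mu=\sum_{x\in\mathbb{V}}f(x)$. The Laplacian is $\Delta u(x)=\sum_{y\sim x}(u(y)-u(x))$ and $|\nabla u|^2(x)=\frac12\sum_{y\sim x}(u(y)-u(x))^2$. $H^1(\mathbb{V})$ is the completion of the finitely supported functions $C_c(\mathbb{V})$ under the norm $\left(\int_{\mathbb{V}}(|\nabla u|^2+u^2)\,d\mu\right)^{1/2}$, and $$X=\left\{u\in H^1(\mathbb{V}):\int_{\mathbb{V}}(V(x)+1)u^2\,d\mu<\infty\right\}.$$ The energy functional $J:X\to(-\infty,+\infty]$ is $$J(u)=\frac12\int_{\mathbb{V}}\left(|\nabla u|^2+(V(x)+1)u^2\right)d\mu-\frac12\int_{\mathbb{V}}u^2\log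 u^2\,d\mu,$$ with the convention $0\log 0=0$ (the last integral may equal $-\infty$, in which case $J(u)=+\infty$). A solution is a function $u\in X$ with $J(u)<+\infty$ satisfying the equation at every $x\in\mathbb{V}$ (with $u\log u^2=0$ where $u=0$). *)

theory Defs
  imports "HOL-Analysis.Analysis"
begin

text \<open>
  The vertex set is the whole type \<open>'v\<close>. A graph is given by its adjacency relation
  \<open>E\<close>, with \<open>(x, y) \<in> E\<close> meaning \<open>x \<sim> y\<close>; it is undirected when \<open>sym E\<close>.
  Loops are not excluded: they contribute \<open>0\<close> to both the Laplacian and the gradient.
\<close>

definition graph_connected :: "('v \<times> 'v) set \<Rightarrow> bool" where
  "graph_connected E \<longleftrightarrow> (\<forall>x y. (x, y) \<in> E\<^sup>*)"

definition uniformly_locally_finite :: "('v \<times> 'v) set \<Rightarrow> bool" where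
  "uniformly_locally_finite E \<longleftrightarrow>
     (\<exists>C::nat. \<forall>x. finite {y. (x, y) \<in> E} \<and> card {y. (x, y) \<in> E} \<le> C)"

definition gdist :: "('v \<times> 'v) set \<Rightarrow> 'v \<Rightarrow> 'v \<Rightarrow> nat" where
  "gdist E x y = (LEAST n. (x, y) \<in> E ^^ n)"

definition laplacian :: "('v \<times> 'v) set \<Rightarrow> ('v \<Rightarrow> real) \<Rightarrow> 'v \<Rightarrow> real" where
  "laplacian E u x = (\<Sum>y\<in>{y. (x, y) \<in> E}. u y - u x)"

definition grad_sq :: "('v \<times> 'v) set \<Rightarrow> ('v \<Rightarrow> real) \<Rightarrow> 'v \<Rightarrow> real" where
  "grad_sq E u x = 1/2 * (\<Sum>y\<in>{y. (x, y) \<in> E}. (u y - u x)\<^sup>2)"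

text \<open>Only used for finitely supported \<open>u\<close>, where the integral is a finite sum.\<close>

definition H1_norm :: "('v \<times> 'v) set \<Rightarrow> ('v \<Rightarrow> real) \<Rightarrow> real" where
  "H1_norm E u = sqrt (\<integral>x. (grad_sq E u x + (u x)\<^sup>2) \<partial>count_space UNIV)"

text \<open>
  The completion of the finitely supported functions under \<open>H1_norm\<close>, realised as a space of functions:
  the norm dominates every point evaluation, so an \<open>H1_norm\<close>-Cauchy sequence converges pointwise,
  and Cauchy sequences represent the same element of the completion iff their pointwise limits
  agree.
\<close>

definition H1 :: "('v \<times> 'v) set \<Rightarrow> ('v \<Rightarrow> real) set" where
  "H1 E = {u. \<exists>\<phi>::nat \<Rightarrow> 'v \<Rightarrow> real.
      (\<forall>n. finite {x. \<phi> n x \<noteq> 0}) \<and>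
      (\<forall>\<epsilon>>0. \<exists>N. \<forall>m\<ge>N. \<forall>n\<ge>N. H1_norm E (\<lambda>x. \<phi> m x - \<phi> n x) < \<epsilon>) \<and>
      (\<forall>x. (\<lambda>n. \<phi> n x) \<longlonglongrightarrow> u x)}"

definition X_space :: "('v \<times> 'v) set \<Rightarrow> ('v \<Rightarrow> real) \<Rightarrow> ('v \<Rightarrow> real) set" where
  "X_space E V = {u \<in> H1 E. integrable (count_space UNIV) (\<lambda>x. (V x + 1) * (u x)\<^sup>2)}"

text \<open>
  The integral of the positive part minus the integral of the negative part, each in
  \<open>[0, \<infinity>]\<close>; note that \<open>ennreal\<close> maps negative reals to \<open>0\<close>. Meaningful when at least one of
  the two is finite.
\<close>

definition ext_integral :: "('v \<Rightarrow> real) \<Rightarrow> ereal" where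
  "ext_integral f =
     enn2ereal (\<integral>\<^sup>+x. ennreal (f x) \<partial>count_space UNIV)
     - enn2ereal (\<integral>\<^sup>+x. ennreal (- f x) \<partial>count_space UNIV)"

text \<open>
  For \<open>u\<close> in \<open>X_space E V\<close> with \<open>inf V > -1\<close>, the first integral is finite and the positive part
  of the second integrand is finitely supported (\<open>u\<close> is square summable, so \<open>\<bar>u x\<bar> > 1\<close> only
  finitely often). Hence no \<open>\<infinity> - \<infinity>\<close> occurs and the value is in \<open>(-\<infinity>, \<infinity>]\<close>. The factor
  \<open>(u x)\<^sup>2\<close> enforces \<open>0 log 0 = 0\<close>.
\<close>

definition J :: "('v \<times> 'v) set \<Rightarrow> ('v \<Rightarrow> real) \<Rightarrow> ('v \<Rightarrow> real) \<Rightarrow> ereal" where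
  "J E V u =
     ereal (1/2) * ext_integral (\<lambda>x. grad_sq E u x + (V x + 1) * (u x)\<^sup>2)
     - ereal (1/2) * ext_integral (\<lambda>x. (u x)\<^sup>2 * ln ((u x)\<^sup>2))"

definition is_solution :: "('v \<times> 'v) set \<Rightarrow> ('v \<Rightarrow> real) \<Rightarrow> ('v \<Rightarrow> real) \<Rightarrow> bool" where
  "is_solution E V u \<longleftrightarrow>
     u \<in> X_space E V \<and> J E V u < \<infinity> \<and>
     (\<forall>x. - laplacian E u x + V x * u x = u x * ln ((u x)\<^sup>2))"

end

theory Submission
  imports Defs "HOL-Homology.Homology" "HOL-Real_Asymp.Real_Asymp"
begin

text \<open>
  The logarithm makes the problem homogeneous up to a multiplier. If \<open>w\<close> has \<open>\<ell>\<^sup>2\<close>-norm \<open>1\<close> and solves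
  \<open>-\<Delta>w + Vw = w log w\<^sup>2 + \<lambda>w\<close>, then \<open>u = exp(\<lambda>/2) w\<close> solves \<open>-\<Delta>u + Vu = u log u\<^sup>2\<close>, and testing this
  equation with \<open>u\<close> gives \<open>J(u) = \<integral>u\<^sup>2/2 = exp(\<lambda>)/2\<close>. So it suffices to find such eigenvectors with
  arbitrarily large \<open>\<lambda>\<close>, that is, arbitrarily high critical values of the even functional
  \<open>\<Phi>(w) = \<integral>(|\<nabla>w|\<^sup>2 + Vw\<^sup>2) - \<integral>w\<^sup>2 log w\<^sup>2\<close> on the unit sphere of \<open>\<ell>\<^sup>2\<close>.

  Enumerate the vertices by the natural numbers. Since \<open>V\<close> tends to infinity, for every \<open>K\<close> there is
  an \<open>n\<close> such that \<open>\<Phi> > K\<close> on all unit vectors whose first \<open>n\<close> coordinates vanish. On the other hand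
  \<open>\<Phi>\<close> is bounded by some \<open>M\<close> on the unit sphere of the first \<open>n + 1\<close> coordinates, and \<open>K\<close>, \<open>n\<close>, \<open>M\<close> do not
  depend on how many further vertices are taken into account. By the Borsuk-Ulam theorem no odd
  continuous deformation can push that \<open>n\<close>-sphere into \<open>{\<Phi> \<le> K}\<close>, because every odd image of it meets
  the set where the first \<open>n\<close> coordinates vanish; hence a critical value lies between \<open>K\<close> and \<open>M\<close>.

  This argument is carried out on finitely many vertices (\<open>truncated_problem_solvable\<close>), with
  \<open>log w\<^sup>2\<close> replaced by \<open>log (max w\<^sup>2 \<epsilon>)\<close>. After this truncation no gradient flow is required: on the unit
  sphere, a constant minus the functional is the restriction of a convex function of \<open>w\<close>, so the map
  sending \<open>w\<close> to the normalised gradient of that convex function is odd and continuous, never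
  increases the functional, and leaves it unchanged only at critical points
  (\<open>trunc_energy_step\<close>, \<open>odd_descent_almost_critical_point\<close>).

  The bounds \<open>K\<close> and \<open>M\<close> make the finite-dimensional solutions precompact: pointwise limits exist, no mass
  escapes because \<open>V\<close> tends to infinity, and the equation at each vertex involves only finitely many
  coordinates, so it survives the limit (\<open>log_nonlinear_eigenvector\<close>).

  The Borsuk-Ulam theorem follows from the fact that odd self-maps of spheres have odd degree
  (\<open>odd_map_odd_degree\<close>). Its induction step compares the degrees of an odd map and of its restriction
  to the equator, provided that the equator is preserved. A general odd map is first brought into
  this position by a homotopy through odd maps (\<open>odd_map_homotopic_equator_preserving\<close>).
\<close>

section \<open>Coordinate spheres and radial normalisation\<close>

abbreviation Sph :: "nat \<Rightarrow> (nat \<Rightarrow> real) set" where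
  "Sph n \<equiv> topspace (nsphere n)"

lemma Sph_iff: "x \<in> Sph n \<longleftrightarrow> (\<Sum>i\<le>n. (x i)\<^sup>2) = 1 \<and> (\<forall>i>n. x i = 0)"
  by (simp add: nsphere)

lemma nsphere_eq_top_of_set: "nsphere n = top_of_set (Sph n)"
  by (simp add: nsphere euclidean_product_topology)

lemma continuous_map_nsphere_iff:
  "continuous_map (nsphere n) (nsphere m) f \<longleftrightarrow> continuous_on (Sph n) f \<and> f \<in> Sph n \<rightarrow> Sph m"
  using nsphere_eq_top_of_set[of n] nsphere_eq_top_of_set[of m]
    continuous_map_subtopology_eu[of "Sph n" "Sph m" f] by simp

lemma continuous_on_coord:
  fixes f :: "'a::topological_space \<Rightarrow> 'b \<Rightarrow> 'c::topological_space"
  shows "continuous_on S f \<Longrightarrow> continuous_on S (\<lambda>x. f x i)"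
  by (rule continuous_on_product_then_coordinatewise)

lemma continuous_on_nth: "continuous_on S (\<lambda>x::nat \<Rightarrow> real. x i)"
  by (rule continuous_on_coord[OF continuous_on_id])

lemma continuous_on_uminus_fun: "continuous_on S (\<lambda>x::nat \<Rightarrow> real. - x)"
  by (rule continuous_on_coordinatewise_then_product)
    (simp add: continuous_on_minus continuous_on_nth)

lemma uminus_uminus_fun [simp]: "- (- x) = (x :: nat \<Rightarrow> real)"
  by (auto simp: fun_eq_iff)

lemma abs_coord_le_1: assumes "x \<in> Sph n" shows "\<bar>x i\<bar> \<le> 1"
proof (cases "i \<le> n")
  case True
  then have "(x i)\<^sup>2 \<le> (\<Sum>i\<le>n. (x i)\<^sup>2)" by (intro member_le_sum) auto
  also have "\<dots> = 1" using assms by (simp add: Sph_iff)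
  finally show ?thesis by (simp add: abs_square_le_1)
next
  case False then show ?thesis using assms by (simp add: Sph_iff)
qed

lemma compact_Sph: "compact (Sph n)"
proof -
  let ?B = "PiE UNIV (\<lambda>i::nat. {-1..1::real})"
  have "compactin (powertop_real UNIV) ?B"
    by (subst compactin_PiE) auto
  then have B: "compact ?B"
    by (simp add: euclidean_product_topology)
  have eq: "Sph n = ?B \<inter> ({x. (\<Sum>i\<le>n. (x i)\<^sup>2) = 1} \<inter> (\<Inter>i\<in>{n<..}. {x. x i = 0}))"
    using abs_coord_le_1[of _ n] by (auto simp: Sph_iff abs_le_iff PiE_iff minus_le_iff)
  have "closed ({x::nat\<Rightarrow>real. (\<Sum>i\<le>n. (x i)\<^sup>2) = 1} \<inter> (\<Inter>i\<in>{n<..}. {x. x i = 0}))"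
    by (intro closed_Int closed_INT ballI closed_Collect_eq continuous_intros continuous_on_nth)
  then show ?thesis unfolding eq using B by (rule compact_Int_closed[rotated])
qed

lemma Sph_sum: "w \<in> Sph m \<Longrightarrow> (\<Sum>i\<le>m. (w i)\<^sup>2) = 1"
  by (simp add: Sph_iff)

lemma Sph_mono:
  assumes "n \<le> m" shows "Sph n \<subseteq> Sph m"
proof
  fix x assume x: "x \<in> Sph n"
  have "(\<Sum>i\<le>m. (x i)\<^sup>2) = (\<Sum>i\<le>n. (x i)\<^sup>2)"
    using x assms by (intro sum.mono_neutral_right) (auto simp: Sph_iff)
  then show "x \<in> Sph m" using x assms by (auto simp: Sph_iff)
qed

lemma uminus_Sph: "x \<in> Sph n \<Longrightarrow> - x \<in> Sph n"
  by (simp add: Sph_iff)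

definition normalized :: "nat \<Rightarrow> (nat \<Rightarrow> real) \<Rightarrow> nat \<Rightarrow> real" where
  "normalized n x i = (if i \<le> n then x i / L2_set x {..n} else 0)"

lemma L2_set_pos: "i \<le> n \<Longrightarrow> x i \<noteq> 0 \<Longrightarrow> 0 < L2_set x {..n::nat}"
  by (metis L2_set_eq_0_iff L2_set_nonneg atMost_iff finite_atMost order_le_less)

lemma normalized_in_Sph: assumes "i \<le> n" "x i \<noteq> 0" shows "normalized n x \<in> Sph n"
proof -
  have p: "0 < L2_set x {..n}" using assms by (rule L2_set_pos)
  have "(\<Sum>i\<le>n. (normalized n x i)\<^sup>2) = (\<Sum>i\<le>n. (x i)\<^sup>2) / (L2_set x {..n})\<^sup>2"
    by (simp add: normalized_def power_divide sum_divide_distrib)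
  also have "\<dots> = 1" using p by (simp add: L2_set_def sum_nonneg)
  finally show ?thesis by (simp add: Sph_iff normalized_def)
qed

lemma normalized_Sph_eq: "x \<in> Sph n \<Longrightarrow> normalized n x = x"
  by (auto simp: normalized_def Sph_iff L2_set_def fun_eq_iff)

lemma normalized_uminus: "normalized n (- x) = - normalized n x"
  by (auto simp: normalized_def fun_eq_iff L2_set_def)

lemma continuous_on_normalized:
  assumes f: "continuous_on S f" and nz: "\<And>x. x \<in> S \<Longrightarrow> \<exists>i\<le>n. f x i \<noteq> 0"
  shows "continuous_on S (\<lambda>x. normalized n (f x))"
proof (rule continuous_on_coordinatewise_then_product)
  fix i
  show "continuous_on S (\<lambda>x. normalized n (f x) i)"
  proof (cases "i \<le> n")
    case True
    have "L2_set (f x) {..n} \<noteq> 0" if "x \<in> S" for x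
      using nz[OF that] L2_set_pos by (metis less_irrefl)
    then have "continuous_on S (\<lambda>x. f x i / L2_set (f x) {..n})"
      unfolding L2_set_def
      by (intro continuous_on_divide continuous_on_coord[OF f] continuous_on_real_sqrt continuous_on_sum
          continuous_on_power) auto
    with True show ?thesis by (simp add: normalized_def)
  qed (simp add: normalized_def)
qed

text \<open>Straight-line homotopies avoiding the origin can be pushed radially onto the sphere; all
  homotopies of odd maps below have this form.\<close>
lemma nsphere_homotopic_normalized:
  assumes a: "continuous_on (Sph n) a" and b: "continuous_on (Sph n) b"
    and nz: "\<And>x t. x \<in> Sph n \<Longrightarrow> 0 \<le> t \<Longrightarrow> t \<le> 1 \<Longrightarrow> \<exists>i\<le>m. (1-t) * a x i + t * b x i \<noteq> 0"
  shows "homotopic_with (\<lambda>x. True) (nsphere n) (nsphere m) (\<lambda>x. normalized m (a x)) (\<lambda>x. normalized m (b x))"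
proof -
  let ?h = "\<lambda>z. normalized m (\<lambda>i. (1 - fst z) * a (snd z) i + fst z * b (snd z) i)"
  have ca: "continuous_on ({0..1::real} \<times> Sph n) (\<lambda>z. a (snd z))"
    by (rule continuous_on_compose2[OF a continuous_on_snd[OF continuous_on_id]]) auto
  have cb: "continuous_on ({0..1::real} \<times> Sph n) (\<lambda>z. b (snd z))"
    by (rule continuous_on_compose2[OF b continuous_on_snd[OF continuous_on_id]]) auto
  have c: "continuous_on ({0..1::real} \<times> Sph n) ?h"
    using nz by (intro continuous_on_normalized continuous_on_coordinatewise_then_product continuous_on_add continuous_on_mult
        continuous_on_diff continuous_on_const continuous_on_fst continuous_on_id continuous_on_coord[OF ca] continuous_on_coord[OF cb]) auto
  have r: "?h z \<in> Sph m" if "z \<in> {0..1::real} \<times> Sph n" for z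
    using nz[of "snd z" "fst z"] normalized_in_Sph that by (metis (no_types, lifting) SigmaE atLeastAtMost_iff fst_conv snd_conv)
  have "continuous_map (prod_topology (top_of_set {0..1}) (top_of_set (Sph n))) (top_of_set (Sph m)) ?h"
    using c r by simp
  then show ?thesis
    unfolding homotopic_with_def using nsphere_eq_top_of_set[of n] nsphere_eq_top_of_set[of m]
    by (intro exI[of _ ?h]) simp
qed

section \<open>General position for odd maps\<close>

text \<open>Lipschitz functions form an algebra that separates points, so the Stone-Weierstrass theorem
  approximates by them. The Lipschitz constant refers to the sum distance of the first \<open>n + 1\<close>
  coordinates, which is the form that the grid-counting argument below needs.\<close>
lemma lipschitz_stone_weierstrass:
  fixes S :: "(nat \<Rightarrow> real) set"
  assumes S: "compact S" and supp: "S \<subseteq> {x. \<forall>i>n. x i = 0}"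
    and f: "continuous_on S f" and e: "e > 0"
  obtains g L where "continuous_on S g" "0 \<le> L"
    "\<And>x y. x \<in> S \<Longrightarrow> y \<in> S \<Longrightarrow> \<bar>g x - g y\<bar> \<le> L * (\<Sum>j\<le>n. \<bar>x j - y j\<bar>)"
    "\<And>x. x \<in> S \<Longrightarrow> \<bar>f x - g x\<bar> < e"
proof -
  define P where "P g \<longleftrightarrow> continuous_on S g \<and>
      (\<exists>L\<ge>0. \<forall>x\<in>S. \<forall>y\<in>S. \<bar>g x - g y\<bar> \<le> L * (\<Sum>j\<le>n. \<bar>x j - y j\<bar>))" for g :: "(nat \<Rightarrow> real) \<Rightarrow> real"
  have "\<exists>g. P g \<and> (\<forall>x\<in>S. \<bar>f x - g x\<bar> < e)"
  proof (rule Stone_Weierstrass_HOL[OF S _ _ _ _ _ f e])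
    show "P (\<lambda>x. c)" for c unfolding P_def by (intro conjI exI[of _ 0]) auto
    show "P g \<Longrightarrow> continuous_on S g" for g by (simp add: P_def)
    show "P (\<lambda>x. g x + h x)" if PP: "P g \<and> P h" for g h
    proof -
      obtain L where L: "L \<ge> 0"
        and g: "\<And>x y. x \<in> S \<Longrightarrow> y \<in> S \<Longrightarrow> \<bar>g x - g y\<bar> \<le> L * (\<Sum>j\<le>n. \<bar>x j - y j\<bar>)"
        using PP unfolding P_def by blast
      obtain M where M: "M \<ge> 0"
        and h: "\<And>x y. x \<in> S \<Longrightarrow> y \<in> S \<Longrightarrow> \<bar>h x - h y\<bar> \<le> M * (\<Sum>j\<le>n. \<bar>x j - y j\<bar>)"
        using PP unfolding P_def by blast
      have "\<bar>g x + h x - (g y + h y)\<bar> \<le> (L + M) * (\<Sum>j\<le>n. \<bar>x j - y j\<bar>)" if "x \<in> S" "y \<in> S" for x y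
        using g[OF that] h[OF that] by (simp add: ring_distribs)
      then show ?thesis using PP L M unfolding P_def
        by (intro conjI continuous_on_add exI[of _ "L + M"]) auto
    qed
    show "P (\<lambda>x. g x * h x)" if PP: "P g \<and> P h" for g h
    proof -
      obtain L where L: "L \<ge> 0"
        and g: "\<And>x y. x \<in> S \<Longrightarrow> y \<in> S \<Longrightarrow> \<bar>g x - g y\<bar> \<le> L * (\<Sum>j\<le>n. \<bar>x j - y j\<bar>)"
        using PP unfolding P_def by blast
      obtain M where M: "M \<ge> 0"
        and h: "\<And>x y. x \<in> S \<Longrightarrow> y \<in> S \<Longrightarrow> \<bar>h x - h y\<bar> \<le> M * (\<Sum>j\<le>n. \<bar>x j - y j\<bar>)"
        using PP unfolding P_def by blast
      have "bounded (g ` S)" "bounded (h ` S)"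
        using PP S unfolding P_def by (auto intro!: compact_imp_bounded compact_continuous_image)
      then obtain A B where "A > 0" "\<forall>v\<in>g ` S. norm v \<le> A" "B > 0" "\<forall>v\<in>h ` S. norm v \<le> B"
        unfolding bounded_pos by blast
      then have A: "\<And>x. x \<in> S \<Longrightarrow> \<bar>g x\<bar> \<le> A" and B: "\<And>x. x \<in> S \<Longrightarrow> \<bar>h x\<bar> \<le> B"
        and AB: "A \<ge> 0" "B \<ge> 0"
        by auto
      have "\<bar>g x * h x - g y * h y\<bar> \<le> (A * M + B * L) * (\<Sum>j\<le>n. \<bar>x j - y j\<bar>)" if "x \<in> S" "y \<in> S" for x y
      proof -
        let ?s = "\<Sum>j\<le>n. \<bar>x j - y j\<bar>"
        have "g x * h x - g y * h y = g x * (h x - h y) + h y * (g x - g y)" by (simp add: algebra_simps)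
        also have "\<bar>\<dots>\<bar> \<le> \<bar>g x\<bar> * \<bar>h x - h y\<bar> + \<bar>h y\<bar> * \<bar>g x - g y\<bar>"
          by (metis abs_mult abs_triangle_ineq)
        also have "\<dots> \<le> A * (M * ?s) + B * (L * ?s)"
          using A B g h that AB by (intro add_mono mult_mono) auto
        finally show ?thesis by (simp add: algebra_simps)
      qed
      then show ?thesis using PP L M AB unfolding P_def
        by (intro conjI continuous_on_mult exI[of _ "A * M + B * L"]) auto
    qed
    show "\<exists>f. P f \<and> f x \<noteq> f y" if xy: "x \<in> S \<and> y \<in> S \<and> x \<noteq> y" for x y
    proof -
      obtain i where i: "x i \<noteq> y i" using xy by (auto simp: fun_eq_iff)
      then have "i \<le> n" using xy supp by (metis (mono_tags, lifting) mem_Collect_eq not_le subsetD)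
      then have "\<bar>a i - b i\<bar> \<le> 1 * (\<Sum>j\<le>n. \<bar>a j - b j\<bar>)" for a b :: "nat \<Rightarrow> real"
        using member_le_sum[of i "{..n}" "\<lambda>j. \<bar>a j - b j\<bar>"] by simp
      then have "P (\<lambda>x. x i)" unfolding P_def
        using continuous_on_nth zero_le_one by blast
      with i show ?thesis by (intro exI[of _ "\<lambda>x. x i"] conjI)
    qed
  qed
  then show ?thesis using that unfolding P_def by blast
qed

text \<open>Oddness of the approximation comes for free by passing to the odd part
  \<open>(g x - g (- x)) / 2\<close>, which is at least as close to an odd map as \<open>g\<close> is.\<close>
lemma odd_lipschitz_approx:
  fixes f :: "(nat \<Rightarrow> real) \<Rightarrow> nat \<Rightarrow> real"
  assumes f: "continuous_on (Sph n) f" and odd: "\<And>x. x \<in> Sph n \<Longrightarrow> f (- x) = - f x" and e: "e > 0"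
  shows "\<exists>p L. continuous_on (Sph n) p \<and> (\<forall>x. p (- x) = - p x) \<and> 0 \<le> L \<and>
    (\<forall>x\<in>Sph n. \<forall>y\<in>Sph n. \<forall>i\<le>m. \<bar>p x i - p y i\<bar> \<le> L * (\<Sum>j\<le>n. \<bar>x j - y j\<bar>)) \<and>
    (\<forall>x\<in>Sph n. \<forall>i. \<bar>f x i - p x i\<bar> < e)"
proof -
  define Q where "Q i g L \<longleftrightarrow> continuous_on (Sph n) g \<and> 0 \<le> L \<and>
      (\<forall>x\<in>Sph n. \<forall>y\<in>Sph n. \<bar>g x - g y\<bar> \<le> L * (\<Sum>j\<le>n. \<bar>x j - y j\<bar>)) \<and>
      (\<forall>x\<in>Sph n. \<bar>f x i - g x\<bar> < e)" for i g L
  have Q: "\<exists>g L. Q i g L" for i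
  proof -
    have supp: "Sph n \<subseteq> {x. \<forall>j>n. x j = 0}"
      by (auto simp: Sph_iff)
    show ?thesis unfolding Q_def
      by (rule lipschitz_stone_weierstrass[OF compact_Sph supp continuous_on_coord[OF f, of i] e])
        (intro exI conjI ballI; assumption | simp)
  qed
  obtain g L where gL: "\<And>i. Q i (g i) (L i)"
    using Q by metis
  then have g: "\<And>i. continuous_on (Sph n) (g i)" and L: "\<And>i. 0 \<le> L i"
    and lip: "\<And>i x y. x\<in>Sph n \<Longrightarrow> y\<in>Sph n \<Longrightarrow> \<bar>g i x - g i y\<bar> \<le> L i * (\<Sum>j\<le>n. \<bar>x j - y j\<bar>)"
    and close: "\<And>i x. x\<in>Sph n \<Longrightarrow> \<bar>f x i - g i x\<bar> < e"
    unfolding Q_def by blast+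
  define p where "p x i = (g i x - g i (- x)) / 2" for x and i :: nat
  show ?thesis
  proof (intro exI[of _ p] exI[of _ "sum L {..m}"] conjI allI ballI impI)
    have "continuous_on (Sph n) (\<lambda>x. g i (- x))" for i
      by (rule continuous_on_compose2[OF g[of i] continuous_on_uminus_fun]) (auto simp: uminus_Sph)
    then show "continuous_on (Sph n) p"
      unfolding p_def by (intro continuous_on_coordinatewise_then_product continuous_intros g) auto
    show "p (- x) = - p x" for x by (auto simp: p_def fun_eq_iff field_simps)
    show "0 \<le> sum L {..m}" by (simp add: L sum_nonneg)
    show "\<bar>p x i - p y i\<bar> \<le> sum L {..m} * (\<Sum>j\<le>n. \<bar>x j - y j\<bar>)"
      if xy: "x \<in> Sph n" "y \<in> Sph n" "i \<le> m" for x y i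
    proof -
      have "\<bar>p x i - p y i\<bar> \<le> (\<bar>g i x - g i y\<bar> + \<bar>g i (-x) - g i (-y)\<bar>) / 2"
      proof -
        have "p x i - p y i = ((g i x - g i y) - (g i (- x) - g i (- y))) / 2"
          by (simp add: p_def field_simps)
        then show ?thesis
          using abs_triangle_ineq4[of "g i x - g i y" "g i (- x) - g i (- y)"]
          by (simp only: abs_divide) simp
      qed
      also have "\<dots> \<le> L i * (\<Sum>j\<le>n. \<bar>x j - y j\<bar>)"
        using lip[OF xy(1,2), of i] lip[OF uminus_Sph[OF xy(1)] uminus_Sph[OF xy(2)], of i]
        by (simp add: abs_minus_commute)
      also have "\<dots> \<le> sum L {..m} * (\<Sum>j\<le>n. \<bar>x j - y j\<bar>)"
        using that L by (intro mult_right_mono member_le_sum) (auto intro: sum_nonneg)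
      finally show ?thesis .
    qed
    show "\<bar>f x i - p x i\<bar> < e" if x: "x \<in> Sph n" for x i
      using close[OF x, of i] close[OF uminus_Sph[OF x], of i] odd[OF x]
      unfolding p_def by (simp add: field_simps)
  qed
qed

text \<open>A Lipschitz map cannot cover a cube of dimension \<open>k + 2\<close> by parameters ranging over a bounded
  set of dimension \<open>k + 1\<close>; here \<open>z\<close> selects a parameter for each point of the cube. This is the
  pigeonhole principle: the cube contains \<open>K ^ (k + 2)\<close> grid points of spacing \<open>1/K\<close>, while the
  parameters fall into at most \<open>(C * K) ^ (k + 1)\<close> cells so small that two grid points with parameters
  in one cell have distance less than \<open>1/K\<close>. For \<open>K > C ^ (k + 1)\<close> there are too few cells.\<close>
lemma no_lipschitz_inverse_to_lower_dim:
  fixes z :: "(nat \<Rightarrow> real) \<Rightarrow> nat \<Rightarrow> real" and k :: nat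
  assumes R: "\<And>q j. (\<And>i. i \<le> Suc k \<Longrightarrow> 0 < q i \<and> q i \<le> 1) \<Longrightarrow> j \<le> k \<Longrightarrow> \<bar>z q j\<bar> \<le> R"
    and lip: "\<And>q r i. (\<And>i. i \<le> Suc k \<Longrightarrow> 0 < q i \<and> q i \<le> 1) \<Longrightarrow> (\<And>i. i \<le> Suc k \<Longrightarrow> 0 < r i \<and> r i \<le> 1)
       \<Longrightarrow> i \<le> Suc k \<Longrightarrow> \<bar>q i - r i\<bar> \<le> A * (\<Sum>j\<le>k. \<bar>z q j - z r j\<bar>)"
    and A: "A > 0"
  shows False
proof -
  have R0: "R \<ge> 0" using R[of "\<lambda>_. 1" 0] by simp
  define C where "C = 2 * R * A * (real k + 1) + 5"
  have C: "C > 0" using R0 A by (auto simp: C_def intro!: add_nonneg_pos mult_nonneg_nonneg)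
  obtain K :: nat where K: "C ^ Suc k < real K" using reals_Archimedean2 by blast
  have K0: "K > 0" using K C by (metis less_imp_le of_nat_0_less_iff order_le_less_trans zero_less_power)
  define D where "D = A * (real k + 1) * real K"
  have D: "D > 0" using A K0 by (simp add: D_def)
  define M where "M = nat \<lceil>R * D\<rceil> + 1"
  define G where "G = PiE {..Suc k} (\<lambda>_. {..<K})"
  define H where "H = PiE {..k} (\<lambda>_. {- int M..int M})"
  define q where "q g i = (real (g i) + 1) / real K" for g :: "nat \<Rightarrow> nat" and i :: nat
  define c where "c g = restrict (\<lambda>j. \<lfloor>z (q g) j * D\<rfloor>) {..k}" for g
  have q01: "0 < q g i \<and> q g i \<le> 1" if "g \<in> G" "i \<le> Suc k" for g i
  proof -
    have "g i < K" using that PiE_mem[of g "{..Suc k}" "\<lambda>_. {..<K}" i] by (simp add: G_def)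
    then have "real (g i) + 1 \<le> real K" by linarith
    then show ?thesis using K0 by (simp add: q_def divide_le_eq_1 add_nonneg_pos)
  qed
  have cH: "c g \<in> H" if g: "g \<in> G" for g
  proof -
    have "\<lfloor>z (q g) j * D\<rfloor> \<in> {- int M..int M}" if "j \<le> k" for j
    proof -
      have "\<bar>z (q g) j\<bar> \<le> R" using R[of "q g" j] q01[OF g] that by blast
      then have "\<bar>z (q g) j\<bar> * D \<le> R * D" using D by simp
      then have "\<bar>z (q g) j * D\<bar> \<le> R * D" using D by (simp add: abs_mult)
      moreover have "R * D \<le> real M"
        unfolding M_def using real_nat_ceiling_ge[of "R * D"] by simp
      ultimately have "\<bar>z (q g) j * D\<bar> \<le> real M" by (rule order_trans)
      then have "z (q g) j * D \<le> real M" "- real M \<le> z (q g) j * D"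
        by (auto simp: abs_le_iff)
      then show ?thesis by (simp add: floor_le_iff le_floor_iff)
    qed
    then show ?thesis by (simp add: H_def c_def)
  qed
  have inj: "inj_on c G"
  proof (rule inj_onI)
    fix g h assume gh: "g \<in> G" "h \<in> G" "c g = c h"
    have cell: "\<bar>z (q g) j - z (q h) j\<bar> \<le> 1 / D" if "j \<le> k" for j
    proof -
      have "\<lfloor>z (q g) j * D\<rfloor> = \<lfloor>z (q h) j * D\<rfloor>"
        using fun_cong[OF gh(3), of j] that by (simp add: c_def)
      then have "\<bar>z (q g) j * D - z (q h) j * D\<bar> \<le> 1" by linarith
      then have "\<bar>z (q g) j - z (q h) j\<bar> * D \<le> 1"
        using D by (simp add: abs_mult left_diff_distrib[symmetric])
      then show ?thesis using D by (simp add: field_simps)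
    qed
    \<comment> \<open>One strict coordinate is enough to make the distance of the grid points less than the spacing.\<close>
    have strict: "\<bar>z (q g) 0 - z (q h) 0\<bar> < 1 / D"
    proof -
      have "\<lfloor>z (q g) 0 * D\<rfloor> = \<lfloor>z (q h) 0 * D\<rfloor>"
        using fun_cong[OF gh(3), of 0] by (simp add: c_def)
      then have "\<bar>z (q g) 0 * D - z (q h) 0 * D\<bar> < 1" by linarith
      then have "\<bar>z (q g) 0 - z (q h) 0\<bar> * D < 1"
        using D by (simp add: abs_mult left_diff_distrib[symmetric])
      then show ?thesis using D by (simp add: field_simps)
    qed
    have "(\<Sum>j\<le>k. \<bar>z (q g) j - z (q h) j\<bar>) < (\<Sum>j\<le>k. 1 / D)"
      using cell strict by (intro sum_strict_mono_ex1) auto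
    then have "A * (\<Sum>j\<le>k. \<bar>z (q g) j - z (q h) j\<bar>) < A * (\<Sum>j\<le>k. 1 / D)"
      using A by (rule mult_strict_left_mono)
    also have "\<dots> = 1 / real K"
      using A K0 by (simp add: D_def divide_simps)
    finally have sm: "A * (\<Sum>j\<le>k. \<bar>z (q g) j - z (q h) j\<bar>) < 1 / real K" .
    have "g i = h i" if "i \<le> Suc k" for i
    proof -
      have "\<bar>q g i - q h i\<bar> < 1 / real K"
        using lip[of "q g" "q h" i] q01[OF gh(1)] q01[OF gh(2)] that sm by fastforce
      then have "\<bar>real (g i) - real (h i)\<bar> / real K < 1 / real K"
        by (simp add: q_def diff_divide_distrib[symmetric])
      then have "\<bar>real (g i) - real (h i)\<bar> < 1"
        using K0 by (simp add: divide_less_cancel del: abs_divide)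
      then show ?thesis by linarith
    qed
    then show "g = h" using gh(1,2) unfolding G_def by (intro PiE_ext[of g "{..Suc k}" "\<lambda>_. {..<K}" h]) auto
  qed
  have "card G \<le> card H"
    using inj cH by (intro card_inj_on_le[of c]) (auto simp: H_def intro: finite_PiE)
  moreover have "card G = K ^ Suc (Suc k)" by (simp add: G_def card_PiE)
  moreover have "card H = (2 * M + 1) ^ Suc k" by (simp add: H_def card_PiE nat_add_distrib nat_mult_distrib)
  ultimately have 1: "real K ^ Suc (Suc k) \<le> real (2 * M + 1) ^ Suc k"
    by (metis of_nat_le_iff of_nat_power)
  have K1: "real K \<ge> 1" using K0 by simp
  have "real M \<le> R * D + 2" unfolding M_def using R0 D by (simp add: ceiling_le_iff) linarith
  then have "real (2 * M + 1) \<le> 2 * R * D + 5" by simp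
  also have "\<dots> \<le> C * real K" using K1 by (simp add: C_def D_def ring_distribs)
  finally have "real (2 * M + 1) ^ Suc k \<le> (C * real K) ^ Suc k" by (intro power_mono) auto
  also have "\<dots> = C ^ Suc k * real K ^ Suc k" by (rule power_mult_distrib)
  also have "\<dots> < real K * real K ^ Suc k" using K K0 by (intro mult_strict_right_mono) auto
  finally show False using 1 by simp
qed

text \<open>Dimension count for lines: the lines through the origin that meet the image of the \<open>k\<close>-sphere
  under \<open>p\<close> form a set of dimension \<open>k + 1\<close> in a space of dimension \<open>k + 2\<close>, so some line is missed. The
  points of these lines are \<open>s * p x\<close>; they are parametrised in a Lipschitz way by the vectors \<open>s * x\<close>
  of the space of dimension \<open>k + 1\<close>, where oddness of \<open>p\<close> reduces to \<open>s \<ge> 0\<close>. The direction is found in the positive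
  orthant, so that it is transversal to the equator hyperplane.\<close>
lemma lipschitz_misses_line:
  fixes p :: "(nat \<Rightarrow> real) \<Rightarrow> nat \<Rightarrow> real" and k :: nat
  assumes odd: "\<And>x. x \<in> Sph k \<Longrightarrow> p (- x) = - p x"
    and L: "0 \<le> L"
    and lip: "\<And>x y i. x \<in> Sph k \<Longrightarrow> y \<in> Sph k \<Longrightarrow> i \<le> Suc k \<Longrightarrow>
       \<bar>p x i - p y i\<bar> \<le> L * (\<Sum>j\<le>k. \<bar>x j - y j\<bar>)"
    and B: "\<And>x i. x \<in> Sph k \<Longrightarrow> i \<le> Suc k \<Longrightarrow> \<bar>p x i\<bar> \<le> B"
    and m: "m > 0" "\<And>x. x \<in> Sph k \<Longrightarrow> \<exists>i\<le>Suc k. m \<le> \<bar>p x i\<bar>"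
  obtains q :: "nat \<Rightarrow> real" where "\<And>i. i \<le> Suc k \<Longrightarrow> 0 < q i"
    "\<And>x s. x \<in> Sph k \<Longrightarrow> \<exists>i\<le>Suc k. q i \<noteq> s * p x i"
proof (rule ccontr)
  note avoid = that
  assume neg: "\<not> thesis"
  have "\<exists>w. fst w \<in> Sph k \<and> snd w \<ge> 0 \<and> (\<forall>i\<le>Suc k. q i = snd w * p (fst w) i)"
    if qpos: "\<forall>i\<le>Suc k. 0 < q i" for q :: "nat \<Rightarrow> real"
  proof -
    obtain x s where xs: "x \<in> Sph k" "\<forall>i\<le>Suc k. q i = s * p x i"
      using neg avoid qpos by blast
    show ?thesis
    proof (cases "s \<ge> 0")
      case True then show ?thesis using xs by (intro exI[of _ "(x, s)"]) simp
    next
      case False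
      then show ?thesis using xs odd uminus_Sph by (intro exI[of _ "(- x, - s)"]) simp
    qed
  qed
  then have "\<forall>q. \<exists>w. (\<forall>i\<le>Suc k. 0 < q i) \<longrightarrow>
      fst w \<in> Sph k \<and> snd w \<ge> 0 \<and> (\<forall>i\<le>Suc k. q i = snd w * p (fst w) i)"
    by blast
  then obtain W where W: "\<forall>q. (\<forall>i\<le>Suc k. 0 < q i) \<longrightarrow>
      fst (W q) \<in> Sph k \<and> snd (W q) \<ge> 0 \<and> (\<forall>i\<le>Suc k. q i = snd (W q) * p (fst (W q)) i)"
    by (rule exE[OF choice])
  define X where "X q = fst (W q)" for q
  define s where "s q = snd (W q)" for q
  have X: "\<And>q. \<forall>i\<le>Suc k. 0 < q i \<Longrightarrow> X q \<in> Sph k"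
    and s: "\<And>q. \<forall>i\<le>Suc k. 0 < q i \<Longrightarrow> s q \<ge> 0"
    and q: "\<And>q i. \<forall>i\<le>Suc k. 0 < q i \<Longrightarrow> i \<le> Suc k \<Longrightarrow> q i = s q * p (X q) i"
    using W unfolding X_def s_def by blast+
  define z where "z q j = s q * X q j" for q j
  define A where "A = B + L * (real k + 1) + L + 1"
  have B0: "B \<ge> 0" using B[OF X[of "\<lambda>_. 1"], of 0] by simp
  have sz: "s q = L2_set (z q) {..k}" if "\<forall>i\<le>Suc k. 0 < q i" for q
    using X[OF that] s[OF that]
    by (simp add: z_def L2_set_def power_mult_distrib Sph_iff flip: sum_distrib_left)
  show False
  proof (rule no_lipschitz_inverse_to_lower_dim[of k z "1 / m" A])
    show "A > 0" using B0 L by (simp add: A_def add_nonneg_pos)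
    show "\<bar>z q j\<bar> \<le> 1 / m" if q01: "\<And>i. i \<le> Suc k \<Longrightarrow> 0 < q i \<and> q i \<le> 1" for q j
    proof -
      have qp: "\<forall>i\<le>Suc k. 0 < q i" using q01 by blast
      obtain i where i: "i \<le> Suc k" "m \<le> \<bar>p (X q) i\<bar>" using m(2)[OF X[OF qp]] by blast
      have "s q * m \<le> s q * \<bar>p (X q) i\<bar>" using i s[OF qp] by (intro mult_left_mono)
      also have "\<dots> = \<bar>s q * p (X q) i\<bar>" using s[OF qp] by (simp add: abs_mult)
      also have "\<dots> = q i" using q[OF qp i(1)] q01[OF i(1)] by simp
      also have "\<dots> \<le> 1" using q01 i by blast
      finally have sm: "s q \<le> 1 / m" using m(1) by (simp add: field_simps)
      have "\<bar>z q j\<bar> \<le> s q * 1" unfolding z_def abs_mult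
        using abs_coord_le_1[OF X[OF qp]] s[OF qp] by (intro mult_mono) auto
      with sm show ?thesis by simp
    qed
    show "\<bar>q i - r i\<bar> \<le> A * (\<Sum>j\<le>k. \<bar>z q j - z r j\<bar>)"
      if q01: "\<And>i. i \<le> Suc k \<Longrightarrow> 0 < q i \<and> q i \<le> 1" and r01: "\<And>i. i \<le> Suc k \<Longrightarrow> 0 < r i \<and> r i \<le> 1"
        and i: "i \<le> Suc k" for q r i
    proof -
      let ?Z = "\<Sum>j\<le>k. \<bar>z q j - z r j\<bar>"
      have qp: "\<forall>i\<le>Suc k. 0 < q i" and rp: "\<forall>i\<le>Suc k. 0 < r i" using q01 r01 by blast+
      have Z0: "?Z \<ge> 0" by (simp add: sum_nonneg)
      have ss: "\<bar>s q - s r\<bar> \<le> ?Z"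
      proof -
        have "L2_set (z q) {..k} \<le> L2_set (\<lambda>j. z q j - z r j) {..k} + L2_set (z r) {..k}"
          using L2_set_triangle_ineq[of "\<lambda>j. z q j - z r j" "z r" "{..k}"] by simp
        moreover have "L2_set (z r) {..k} \<le> L2_set (\<lambda>j. z q j - z r j) {..k} + L2_set (z q) {..k}"
          using L2_set_triangle_ineq[of "\<lambda>j. z r j - z q j" "z q" "{..k}"]
          by (simp add: L2_set_def power2_commute)
        moreover have "L2_set (\<lambda>j. z q j - z r j) {..k} \<le> ?Z" by (rule L2_set_le_sum_abs)
        ultimately show ?thesis unfolding sz[OF qp] sz[OF rp] by linarith
      qed
      have comp: "s r * \<bar>X q j - X r j\<bar> \<le> \<bar>z q j - z r j\<bar> + ?Z" for j
      proof -
        have "s r * \<bar>X q j - X r j\<bar> = \<bar>s r * (X q j - X r j)\<bar>"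
          using s[OF rp] by (simp add: abs_mult)
        also have "s r * (X q j - X r j) = (z q j - z r j) - (s q - s r) * X q j"
          by (simp add: z_def algebra_simps)
        also have "\<bar>\<dots>\<bar> \<le> \<bar>z q j - z r j\<bar> + \<bar>s q - s r\<bar> * \<bar>X q j\<bar>"
          by (metis abs_mult abs_triangle_ineq4)
        also have "\<bar>s q - s r\<bar> * \<bar>X q j\<bar> \<le> ?Z * 1"
          using ss abs_coord_le_1[OF X[OF qp]] by (intro mult_mono) (auto simp: Z0)
        finally show ?thesis by simp
      qed
      have "q i - r i = (s q - s r) * p (X q) i + s r * (p (X q) i - p (X r) i)"
        using q[OF qp i] q[OF rp i] by (simp add: algebra_simps)
      also have "\<bar>\<dots>\<bar> \<le> \<bar>s q - s r\<bar> * \<bar>p (X q) i\<bar> + s r * \<bar>p (X q) i - p (X r) i\<bar>"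
        using s[OF rp] by (metis abs_mult abs_of_nonneg abs_triangle_ineq)
      also have "\<dots> \<le> ?Z * B + s r * (L * (\<Sum>j\<le>k. \<bar>X q j - X r j\<bar>))"
        using ss B[OF X[OF qp] i] lip[OF X[OF qp] X[OF rp] i] s[OF rp]
        by (intro add_mono mult_mono mult_left_mono) (auto simp: Z0)
      also have "s r * (L * (\<Sum>j\<le>k. \<bar>X q j - X r j\<bar>)) = L * (\<Sum>j\<le>k. s r * \<bar>X q j - X r j\<bar>)"
        by (simp add: sum_distrib_left mult_ac)
      also have "\<dots> \<le> L * (\<Sum>j\<le>k. \<bar>z q j - z r j\<bar> + ?Z)"
        using comp L by (intro mult_left_mono sum_mono)
      also have "\<dots> = L * (real k + 2) * ?Z"
        by (simp add: sum.distrib algebra_simps)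
      finally have "\<bar>q i - r i\<bar> \<le> ?Z * B + L * (real k + 2) * ?Z" by simp
      moreover have "A * ?Z = ?Z * B + L * (real k + 2) * ?Z + ?Z"
        by (simp add: A_def algebra_simps)
      ultimately show ?thesis using Z0 by linarith
    qed
  qed
qed

text \<open>Replace \<open>f\<close> by a Lipschitz odd map \<open>p\<close>, choose a direction \<open>q\<close> that \<open>p\<close> misses on the equator, and
  project along \<open>q\<close> onto the hyperplane of the equator. The projection \<open>\<pi>\<close> has no zero on the equator, but may
  have zeros elsewhere. The even function \<open>\<theta>\<close>, which is \<open>1\<close> on the equator and \<open>0\<close> where \<open>\<pi>\<close> vanishes,
  interpolates between \<open>p\<close> and \<open>\<pi>\<close> without creating zeros.\<close>
lemma odd_map_homotopic_equator_preserving: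
  assumes f: "continuous_map (nsphere (Suc k)) (nsphere (Suc k)) f"
    and odd: "\<And>x. x \<in> Sph (Suc k) \<Longrightarrow> f (- x) = - f x"
  shows "\<exists>h. homotopic_with (\<lambda>x. True) (nsphere (Suc k)) (nsphere (Suc k)) f h \<and>
    (\<forall>x. h (- x) = - h x) \<and> h \<in> Sph k \<rightarrow> Sph k"
proof -
  let ?n = "Suc k"
  have fc: "continuous_on (Sph ?n) f" and fS: "\<And>x. x \<in> Sph ?n \<Longrightarrow> f x \<in> Sph ?n"
    using f by (auto simp: continuous_map_nsphere_iff)
  have sub: "Sph k \<subseteq> Sph ?n" by (intro Sph_mono) simp
  \<comment> \<open>Half of a lower bound for the largest coordinate of a unit vector (\<open>large\<close> below), so that the
     straight line from \<open>f\<close> to an \<open>e\<close>-close map stays away from the origin.\<close>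
  define e where "e = 1 / (2 * (real ?n + 1))"
  have e: "e > 0" by (simp add: e_def)
  have large: "\<exists>i\<le>?n. 2 * e \<le> \<bar>y i\<bar>" if y: "y \<in> Sph ?n" for y
  proof (rule ccontr)
    assume small: "\<not> (\<exists>i\<le>?n. 2 * e \<le> \<bar>y i\<bar>)"
    have e2: "2 * e = 1 / (real ?n + 1)" unfolding e_def by (simp add: divide_simps)
    have lt: "\<bar>y i\<bar> < 1 / (real ?n + 1)" if "i \<le> ?n" for i
      using small that unfolding e2 not_ex by (metis not_le)
    have "(y i)\<^sup>2 \<le> \<bar>y i\<bar>" for i
      using abs_coord_le_1[OF y, of i] by (metis abs_ge_zero mult_left_le power2_abs power2_eq_square)
    then have "(\<Sum>i\<le>?n. (y i)\<^sup>2) \<le> (\<Sum>i\<le>?n. \<bar>y i\<bar>)" by (intro sum_mono)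
    also have "\<dots> < (\<Sum>i\<le>?n. 1 / (real ?n + 1))" using lt by (intro sum_strict_mono) auto
    also have "\<dots> = 1" by (simp add: field_simps)
    finally show False using y by (simp add: Sph_iff)
  qed
  obtain p L where pc: "continuous_on (Sph ?n) p" and podd: "\<And>x. p (- x) = - p x" and L: "0 \<le> L"
    and lip: "\<And>x y i. x \<in> Sph ?n \<Longrightarrow> y \<in> Sph ?n \<Longrightarrow> i \<le> ?n \<Longrightarrow>
        \<bar>p x i - p y i\<bar> \<le> L * (\<Sum>j\<le>?n. \<bar>x j - y j\<bar>)"
    and close: "\<And>x i. x \<in> Sph ?n \<Longrightarrow> i \<le> ?n \<Longrightarrow> \<bar>f x i - p x i\<bar> < e"
    using odd_lipschitz_approx[OF fc odd e, where m = ?n] by blast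
  have pbig: "\<exists>i\<le>?n. e \<le> \<bar>p x i\<bar>" if "x \<in> Sph ?n" for x
  proof -
    obtain i where i: "i \<le> ?n" "2 * e \<le> \<bar>f x i\<bar>" using large[OF fS[OF \<open>x \<in> Sph ?n\<close>]] by blast
    then have "e \<le> \<bar>p x i\<bar>" using close[OF \<open>x \<in> Sph ?n\<close> i(1)] by linarith
    then show ?thesis using i(1) by blast
  qed
  obtain q where qpos: "\<And>i. i \<le> ?n \<Longrightarrow> 0 < q i"
    and qmiss: "\<And>x s. x \<in> Sph k \<Longrightarrow> \<exists>i\<le>?n. q i \<noteq> s * p x i"
  proof (rule lipschitz_misses_line[of k p L "1 + e" e])
    show "\<bar>p x i - p y i\<bar> \<le> L * (\<Sum>j\<le>k. \<bar>x j - y j\<bar>)"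
      if "x \<in> Sph k" "y \<in> Sph k" "i \<le> Suc k" for x y i
    proof -
      have "x (Suc k) = 0" "y (Suc k) = 0" using that by (auto simp: Sph_iff)
      then show ?thesis using lip[of x y i] that sub by auto
    qed
    show "\<bar>p x i\<bar> \<le> 1 + e" if "x \<in> Sph k" "i \<le> Suc k" for x i
    proof -
      have x: "x \<in> Sph ?n" using that sub by blast
      show ?thesis using close[OF x \<open>i \<le> Suc k\<close>] abs_coord_le_1[OF fS[OF x], of i] by linarith
    qed
    show "\<exists>i\<le>Suc k. e \<le> \<bar>p x i\<bar>" if "x \<in> Sph k" for x using pbig that sub by blast
  qed (use podd L e in blast)+
  have q0: "q ?n > 0" using qpos by simp
  define \<pi> where "\<pi> x i = p x i - p x ?n / q ?n * q i" for x and i :: nat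
  have \<pi>n: "\<pi> x ?n = 0" for x using q0 by (simp add: \<pi>_def)
  have \<pi>0: "\<exists>i\<le>?n. \<pi> x i \<noteq> 0" if x: "x \<in> Sph k" for x
  proof (rule ccontr)
    assume "\<not> (\<exists>i\<le>?n. \<pi> x i \<noteq> 0)"
    then have "\<forall>i\<le>?n. \<pi> x i = 0" by blast
    then have z: "\<forall>i\<le>?n. p x i = p x ?n / q ?n * q i" unfolding \<pi>_def right_minus_eq .
    obtain i where i: "i \<le> ?n" "e \<le> \<bar>p x i\<bar>" using pbig x sub by blast
    have pn: "p x ?n \<noteq> 0"
    proof
      assume "p x ?n = 0"
      moreover have "p x i = p x ?n / q ?n * q i" using z i(1) by blast
      ultimately have "p x i = 0" by simp
      then show False using i(2) e by simp
    qed
    have "\<forall>i\<le>?n. q i = q ?n / p x ?n * p x i"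
    proof (intro allI impI)
      fix i assume "i \<le> ?n"
      then have "p x i = p x ?n / q ?n * q i" using z by blast
      then show "q i = q ?n / p x ?n * p x i" using pn q0 by simp
    qed
    then show False using qmiss[OF x] by blast
  qed
  define d where "d x = (\<Sum>i\<le>?n. \<bar>\<pi> x i\<bar>)" for x
  have d0: "d x \<ge> 0" for x by (simp add: d_def sum_nonneg)
  have d_iff: "d x = 0 \<longleftrightarrow> (\<forall>i\<le>?n. \<pi> x i = 0)" for x
    unfolding d_def by (subst sum_nonneg_eq_0_iff) auto
  define \<theta> where "\<theta> x = d x / (d x + \<bar>x ?n\<bar>)" for x
  have eqk: "x \<in> Sph k" if "x \<in> Sph ?n" "x ?n = 0" for x
    using that by (auto simp: Sph_iff) (metis Suc_lessI)
  have den: "d x + \<bar>x ?n\<bar> > 0" if x: "x \<in> Sph ?n" for x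
  proof (cases "x ?n = 0")
    case True
    then have "d x \<noteq> 0" using eqk[OF x] \<pi>0[of x] d_iff[of x] by blast
    then show ?thesis using d0[of x] by linarith
  next
    case False
    then show ?thesis using d0[of x] by linarith
  qed
  define r where "r x i = p x i - \<theta> x * (p x ?n / q ?n) * q i" for x and i :: nat
  have pci: "continuous_on (Sph ?n) (\<lambda>x. p x i)" for i by (rule continuous_on_coord[OF pc])
  have dc: "continuous_on (Sph ?n) d"
    unfolding d_def \<pi>_def using q0 by (intro continuous_intros pci) auto
  have \<theta>c: "continuous_on (Sph ?n) \<theta>"
    unfolding \<theta>_def using den by (intro continuous_intros dc continuous_on_nth) force
  have rc: "continuous_on (Sph ?n) r"
    unfolding r_def using q0
    by (intro continuous_on_coordinatewise_then_product continuous_intros \<theta>c pci) auto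
  have \<pi>odd: "\<pi> (- x) i = - \<pi> x i" for x i by (simp add: \<pi>_def podd)
  have dodd: "d (- x) = d x" for x by (simp add: d_def \<pi>odd)
  have \<theta>odd: "\<theta> (- x) = \<theta> x" for x by (simp add: \<theta>_def dodd)
  have rodd: "r (- x) = - r x" for x by (auto simp: r_def \<theta>odd podd fun_eq_iff)
  have seg: "\<exists>i\<le>?n. (1 - t) * p x i + t * r x i \<noteq> 0" if x: "x \<in> Sph ?n" for x t
  proof (rule ccontr)
    assume "\<not> (\<exists>i\<le>?n. (1 - t) * p x i + t * r x i \<noteq> 0)"
    moreover have "(1 - t) * p x i + t * r x i = p x i - t * \<theta> x * (p x ?n / q ?n) * q i" for i
      by (simp add: r_def algebra_simps)
    ultimately have "\<forall>i\<le>?n. p x i - t * \<theta> x * (p x ?n / q ?n) * q i = 0" by metis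
    then have *: "\<forall>i\<le>?n. p x i = t * \<theta> x * (p x ?n / q ?n) * q i"
      unfolding right_minus_eq .
    then have "p x ?n = t * \<theta> x * (p x ?n / q ?n) * q ?n" by blast
    then have tn: "t * \<theta> x * p x ?n = p x ?n" using q0 by simp
    have "\<forall>i\<le>?n. \<pi> x i = 0"
    proof (intro allI impI)
      fix i assume "i \<le> ?n"
      then have "p x i = t * \<theta> x * (p x ?n / q ?n) * q i" using * by blast
      also have "\<dots> = (t * \<theta> x * p x ?n) / q ?n * q i" by simp
      finally show "\<pi> x i = 0" by (simp add: \<pi>_def tn)
    qed
    then have "\<theta> x = 0" using d_iff by (simp add: \<theta>_def)
    then have "\<theta> x = 0" using d_iff by (simp add: \<theta>_def)
    obtain i where i: "i \<le> ?n" "e \<le> \<bar>p x i\<bar>" using pbig[OF x] by blast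
    then have "p x i = t * \<theta> x * (p x ?n / q ?n) * q i" using * by blast
    with \<open>\<theta> x = 0\<close> i(2) e show False by simp
  qed
  have hom1: "homotopic_with (\<lambda>x. True) (nsphere ?n) (nsphere ?n) (\<lambda>x. normalized ?n (f x)) (\<lambda>x. normalized ?n (p x))"
  proof (rule nsphere_homotopic_normalized[OF fc pc])
    fix x and t :: real assume x: "x \<in> Sph ?n" and t: "0 \<le> t" "t \<le> 1"
    obtain i where i: "i \<le> ?n" "2 * e \<le> \<bar>f x i\<bar>" using large[OF fS[OF x]] by blast
    have "(1 - t) * f x i + t * p x i = f x i - t * (f x i - p x i)" by (simp add: algebra_simps)
    moreover have "\<bar>t * (f x i - p x i)\<bar> \<le> 1 * e"
      unfolding abs_mult using close[OF x i(1)] t by (intro mult_mono) auto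
    ultimately have "(1 - t) * f x i + t * p x i \<noteq> 0" using i(2) e by linarith
    then show "\<exists>i\<le>?n. (1 - t) * f x i + t * p x i \<noteq> 0" using i(1) by blast
  qed
  have hom2: "homotopic_with (\<lambda>x. True) (nsphere ?n) (nsphere ?n) (\<lambda>x. normalized ?n (p x)) (\<lambda>x. normalized ?n (r x))"
    by (rule nsphere_homotopic_normalized[OF pc rc]) (use seg in blast)
  have hom0: "homotopic_with (\<lambda>x. True) (nsphere ?n) (nsphere ?n) f (\<lambda>x. normalized ?n (f x))"
    by (rule homotopic_with_equal) (use f fS normalized_Sph_eq in auto)
  show ?thesis
  proof (intro exI[of _ "\<lambda>x. normalized ?n (r x)"] conjI allI)
    show "homotopic_with (\<lambda>x. True) (nsphere ?n) (nsphere ?n) f (\<lambda>x. normalized ?n (r x))"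
      using hom0 hom1 hom2 homotopic_with_trans by blast
    show "normalized ?n (r (- x)) = - normalized ?n (r x)" for x by (simp add: rodd normalized_uminus)
    show "(\<lambda>x. normalized ?n (r x)) \<in> Sph k \<rightarrow> Sph k"
    proof
      fix x assume x: "x \<in> Sph k"
      have xn: "x ?n = 0" using x by (simp add: Sph_iff)
      have "d x \<noteq> 0" using \<pi>0[OF x] d_iff by blast
      then have "\<theta> x = 1" using xn by (simp add: \<theta>_def)
      then have rp: "r x = \<pi> x" by (auto simp: r_def \<pi>_def fun_eq_iff)
      have "normalized ?n (r x) \<in> Sph ?n" using \<pi>0[OF x] normalized_in_Sph rp by metis
      moreover have "normalized ?n (r x) ?n = 0" by (simp add: normalized_def rp \<pi>n)
      ultimately show "normalized ?n (r x) \<in> Sph k" by (rule eqk)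
    qed
  qed
qed

section \<open>The Borsuk-Ulam theorem\<close>
theorem odd_map_odd_degree:
  assumes "continuous_map (nsphere n) (nsphere n) f"
    and "\<And>x. x \<in> Sph n \<Longrightarrow> f (- x) = - f x"
  shows "odd (Brouwer_degree2 n f)"
  using assms
proof (induction n arbitrary: f)
  case 0
  define a :: "nat \<Rightarrow> real" where "a i = (if i = 0 then 1 else 0)" for i
  have S: "x = a \<or> x = - a" if "x \<in> Sph 0" for x
    using that by (auto simp: Sph_iff a_def fun_eq_iff power2_eq_1_iff)
  have a: "a \<in> Sph 0" by (simp add: Sph_iff a_def)
  then have fma: "f (- a) = - f a" by (rule 0(2))
  have "f a \<in> Sph 0" using 0(1) a unfolding continuous_map_nsphere_iff by blast
  then have fa: "f a = a \<or> f a = - a" by (rule S)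
  let ?r = "\<lambda>(x::nat\<Rightarrow>real) i. if i = 0 then -x i else x i"
  have ra: "?r a = - a" "?r (- a) = a" by (auto simp: a_def fun_eq_iff)
  from fa show ?case
  proof
    assume "f a = a"
    then have "f x = id x" if "x \<in> Sph 0" for x using S[OF that] fma by auto
    then show ?thesis using Brouwer_degree2_eq[of 0 f id] by simp
  next
    assume "f a = - a"
    then have "f x = ?r x" if "x \<in> Sph 0" for x using S[OF that] fma ra by auto
    then show ?thesis using Brouwer_degree2_eq[of 0 f ?r] Brouwer_degree2_reflection[of 0] by simp
  qed
next
  case (Suc k)
  obtain h where h: "homotopic_with (\<lambda>x. True) (nsphere (Suc k)) (nsphere (Suc k)) f h"
    and hodd: "\<And>x. h (- x) = - h x" and hS: "h \<in> Sph k \<rightarrow> Sph k"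
    using odd_map_homotopic_equator_preserving[OF Suc.prems] by blast
  have hc: "continuous_map (nsphere (Suc k)) (nsphere (Suc k)) h"
    using h homotopic_with_imp_continuous_maps by blast
  have "continuous_map (nsphere k) (nsphere k) h"
    using hc hS unfolding continuous_map_nsphere_iff
    by (auto simp: Sph_iff intro: continuous_on_subset)
  then have "odd (Brouwer_degree2 k h)" using Suc.IH hodd by blast
  moreover have "even (Brouwer_degree2 (Suc k) h - Brouwer_degree2 (Suc k - Suc 0) h)"
  proof (rule Borsuk_odd_mapping_degree_step[OF hc])
    show "(h \<circ> (\<lambda>x i. - x i)) u = ((\<lambda>x i. - x i) \<circ> h) u" for u
      using hodd[of u] by (simp add: fun_Compl_def)
    show "h \<in> Sph (Suc k - Suc 0) \<rightarrow> Sph (Suc k - Suc 0)" using hS by simp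
  qed
  ultimately have "odd (Brouwer_degree2 (Suc k) h)" by simp
  then show ?case using Brouwer_degree2_homotopic[OF h] by simp
qed

text \<open>If the first \<open>n\<close> coordinates of \<open>f\<close> had no common zero, normalising them would give an odd map
  from the \<open>n\<close>-sphere into its equator. Such a map is not surjective, so it has degree \<open>0\<close>, which is
  not odd.\<close>
theorem Borsuk_Ulam_nsphere:
  fixes f :: "(nat \<Rightarrow> real) \<Rightarrow> nat \<Rightarrow> real"
  assumes f: "continuous_on (Sph n) f" and odd: "\<And>x. x \<in> Sph n \<Longrightarrow> f (- x) = - f x"
  shows "\<exists>x\<in>Sph n. \<forall>i<n. f x i = 0"
proof (rule ccontr)
  assume neg: "\<not> ?thesis"
  define g where "g x i = (if i < n then f x i else 0)" for x i
  define b :: "nat \<Rightarrow> real" where "b i = (if i = n then 1 else 0)" for i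
  have gnz: "\<exists>i\<le>n. g x i \<noteq> 0" if "x \<in> Sph n" for x
    using neg that unfolding g_def by (metis less_imp_le)
  have gc: "continuous_on (Sph n) g"
  proof (rule continuous_on_coordinatewise_then_product)
    show "continuous_on (Sph n) (\<lambda>x. g x i)" for i
      by (cases "i < n") (simp_all add: g_def continuous_on_coord[OF f])
  qed
  have cg: "continuous_map (nsphere n) (nsphere n) (\<lambda>x. normalized n (g x))"
    unfolding continuous_map_nsphere_iff using gnz normalized_in_Sph gc
    by (auto intro!: continuous_on_normalized)
  have "normalized n (g (- x)) = - normalized n (g x)" if "x \<in> Sph n" for x
  proof -
    have "g (- x) = - g x" using odd[OF that] by (auto simp: g_def fun_eq_iff)
    then show ?thesis by (simp add: normalized_uminus)
  qed
  with cg have "odd (Brouwer_degree2 n (\<lambda>x. normalized n (g x)))"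
    by (rule odd_map_odd_degree)
  moreover have "Brouwer_degree2 n (\<lambda>x. normalized n (g x)) = 0"
  proof (rule Brouwer_degree2_nonsurjective[OF cg])
    have "b \<in> Sph n" by (simp add: Sph_iff b_def if_distrib[of "\<lambda>x. x ^ 2"] cong: if_cong)
    moreover have "b \<noteq> normalized n (g x)" for x
      by (metis (no_types) b_def div_0 g_def less_irrefl normalized_def zero_neq_one)
    ultimately show "(\<lambda>x. normalized n (g x)) ` Sph n \<noteq> Sph n" by blast
  qed
  ultimately show False by simp
qed

section \<open>Symmetric minimax by iterating an odd descent map\<close>

text \<open>Without a fixed value of \<open>F\<close> under \<open>T\<close> between \<open>c\<close> and \<open>M\<close>, compactness makes each application of
  \<open>T\<close> decrease \<open>F\<close> by a fixed amount \<open>\<delta>\<close> as long as \<open>F \<ge> c\<close>. Finitely many iterations then move the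
  \<open>n\<close>-sphere into \<open>{F \<le> c}\<close>. The iterate is odd, so by Borsuk-Ulam one of its values has vanishing
  first \<open>n\<close> coordinates, where \<open>F > c\<close>.\<close>
lemma odd_descent_almost_critical_point:
  fixes F :: "(nat \<Rightarrow> real) \<Rightarrow> real" and T :: "(nat \<Rightarrow> real) \<Rightarrow> nat \<Rightarrow> real"
  assumes nm: "n \<le> m"
    and F: "continuous_on (Sph m) F" and T: "continuous_on (Sph m) T"
    and TS: "\<And>x. x \<in> Sph m \<Longrightarrow> T x \<in> Sph m" and odd: "\<And>x. x \<in> Sph m \<Longrightarrow> T (- x) = - T x"
    and dec: "\<And>x. x \<in> Sph m \<Longrightarrow> F (T x) \<le> F x"
    and hi: "\<And>x. x \<in> Sph n \<Longrightarrow> F x \<le> M"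
    and lo: "\<And>x. x \<in> Sph m \<Longrightarrow> \<forall>i<n. x i = 0 \<Longrightarrow> c < F x"
  shows "\<exists>x\<in>Sph m. F (T x) = F x \<and> c \<le> F x \<and> F x \<le> M"
proof (rule ccontr)
  assume neg: "\<not> ?thesis"
  have sub: "Sph n \<subseteq> Sph m" by (rule Sph_mono[OF nm])
  define K where "K = Sph m \<inter> F -` {c..M}"
  have K: "compact K"
  proof -
    have "closedin (top_of_set (Sph m)) K"
      unfolding K_def by (intro continuous_closedin_preimage F) auto
    then show ?thesis using compact_Sph closedin_compact by blast
  qed
  have FT: "continuous_on (Sph m) (\<lambda>x. F (T x))"
    by (rule continuous_on_compose2[OF F T]) (use TS in auto)
  have pos: "F x - F (T x) > 0" if "x \<in> K" for x
    using neg dec[of x] that by (force simp: K_def)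
  have "\<exists>\<delta>>0. \<forall>x\<in>K. \<delta> \<le> F x - F (T x)"
  proof (cases "K = {}")
    case True then show ?thesis by (intro exI[of _ 1]) auto
  next
    case False
    have "continuous_on K (\<lambda>x. F x - F (T x))"
      by (rule continuous_on_subset[OF continuous_on_diff[OF F FT]]) (auto simp: K_def)
    from continuous_attains_inf[OF K False this] show ?thesis using pos by blast
  qed
  then obtain \<delta> where \<delta>: "\<delta> > 0" "\<And>x. x \<in> K \<Longrightarrow> \<delta> \<le> F x - F (T x)" by blast
  have iter: "(T ^^ k) x \<in> Sph m \<and> (T ^^ k) (- x) = - (T ^^ k) x" if "x \<in> Sph m" for k x
    using that by (induction k) (auto simp: TS odd)
  have bound: "F ((T ^^ k) x) \<le> max c (M - real k * \<delta>)" if x: "x \<in> Sph n" for k x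
  proof (induction k)
    case 0 then show ?case using hi[OF x] by simp
  next
    case (Suc k)
    let ?y = "(T ^^ k) x"
    have y: "?y \<in> Sph m" using iter x sub by blast
    have yM: "F ?y \<le> max c M" using Suc \<delta>(1) by (smt (verit) mult_nonneg_nonneg of_nat_0_le_iff)
    show ?case
    proof (cases "F ?y \<le> c")
      case True then show ?thesis using dec[OF y] by simp
    next
      case False
      then have "F ?y \<in> {c..M}" using yM by auto
      then have "\<delta> \<le> F ?y - F (T ?y)" using \<delta>(2) y by (simp add: K_def)
      then show ?thesis using Suc False by (simp add: algebra_simps max_def split: if_splits)
    qed
  qed
  obtain k :: nat where "(M - c) / \<delta> < real k" using reals_Archimedean2 by blast
  then have k: "M - real k * \<delta> \<le> c" using \<delta>(1) by (simp add: field_simps)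
  have "continuous_on (Sph m) (T ^^ k)" for k
  proof (induction k)
    case (Suc k)
    have "continuous_on (Sph m) (\<lambda>x. T ((T ^^ k) x))"
      by (rule continuous_on_compose2[OF T Suc]) (use iter in auto)
    then show ?case by (simp add: o_def)
  qed (simp add: continuous_on_id id_def)
  then have "continuous_on (Sph n) (T ^^ k)" using continuous_on_subset sub by blast
  moreover have "(T ^^ k) (- x) = - (T ^^ k) x" if "x \<in> Sph n" for x
    using iter that sub by blast
  ultimately obtain x where x: "x \<in> Sph n" "\<forall>i<n. (T ^^ k) x i = 0"
    using Borsuk_Ulam_nsphere[of n "T ^^ k"] by blast
  have "c < F ((T ^^ k) x)" using lo iter x sub by blast
  moreover have "F ((T ^^ k) x) \<le> c" using bound[OF x(1), of k] k by simp
  ultimately show False by simp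
qed

section \<open>The truncated problem on finitely many vertices\<close>

text \<open>The function \<open>r \<mapsto> r ln (max r e) - max r e\<close> is convex with derivative \<open>ln (max r e)\<close>. Applied to \<open>r = w\<^sup>2\<close>,
  this bounds the entropy difference of two vectors by the linear one that only involves the
  weights \<open>ln (max w\<^sup>2 e)\<close> of the first.\<close>
lemma truncated_entropy_tangent:
  fixes r s e :: real
  assumes e: "e > 0"
  shows "(s * ln (max s e) - max s e) - (r * ln (max r e) - max r e) \<ge> ln (max r e) * (s - r)"
proof -
  let ?m = "max r e" and ?n = "max s e"
  have p: "?m > 0" "?n > 0" using e by auto
  have l1: "ln (?m / ?n) \<le> ?m / ?n - 1" using p by (intro ln_le_minus_one) auto
  have "?n * ln (?m / ?n) \<le> ?n * (?m / ?n - 1)" using l1 p by (intro mult_left_mono) auto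
  also have "\<dots> = ?m - ?n" using p by (simp add: field_simps)
  finally have 1: "?n * (ln ?n - ln ?m) \<ge> ?n - ?m" using p by (simp add: ln_div algebra_simps)
  have "s * (ln ?n - ln ?m) \<ge> ?n * (ln ?n - ln ?m)"
  proof (cases "s \<ge> e")
    case False
    then have "ln ?n - ln ?m \<le> 0" using e p by (simp add: ln_le_cancel_iff)
    then show ?thesis using False by (intro mult_right_mono_neg) auto
  qed simp
  with 1 show ?thesis by (simp add: algebra_simps)
qed

definition trunc_sq :: "real \<Rightarrow> real \<Rightarrow> real" where "trunc_sq e s = max (s\<^sup>2) e"

definition quad_form :: "(nat \<Rightarrow> nat \<Rightarrow> real) \<Rightarrow> nat \<Rightarrow> (nat \<Rightarrow> real) \<Rightarrow> real" where
  "quad_form A m w = (\<Sum>i\<le>m. \<Sum>j\<le>m. A i j * w i * w j)"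

text \<open>The summand is the primitive of \<open>2s ln (max s\<^sup>2 e)\<close> that vanishes at \<open>s = 0\<close>: for \<open>s\<^sup>2 \<le> e\<close> it is \<open>s\<^sup>2 ln e\<close>, for \<open>s\<^sup>2 \<ge> e\<close> it is \<open>s\<^sup>2 ln s\<^sup>2 - s\<^sup>2 + e\<close>.\<close>
definition trunc_energy :: "(nat \<Rightarrow> nat \<Rightarrow> real) \<Rightarrow> nat \<Rightarrow> real \<Rightarrow> (nat \<Rightarrow> real) \<Rightarrow> real" where
  "trunc_energy A m e w = quad_form A m w - (\<Sum>i\<le>m. (w i)\<^sup>2 * ln (trunc_sq e (w i)) - trunc_sq e (w i) + e)"

text \<open>Half of the gradient of \<open>C * |w|\<^sup>2\<close> minus the energy. It is also the linear operator
  \<open>C - A + ln (max w\<^sup>2 e)\<close>, with the diagonal frozen at \<open>w\<close>, applied to \<open>w\<close> itself.\<close>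
definition lin_op :: "(nat \<Rightarrow> nat \<Rightarrow> real) \<Rightarrow> nat \<Rightarrow> real \<Rightarrow> real \<Rightarrow> (nat \<Rightarrow> real) \<Rightarrow> nat \<Rightarrow> real" where
  "lin_op A m e C w i = C * w i - (\<Sum>j\<le>m. A i j * w j) + w i * ln (trunc_sq e (w i))"

lemma trunc_sq_pos: "e > 0 \<Longrightarrow> trunc_sq e s > 0" and trunc_sq_uminus: "trunc_sq e (- s) = trunc_sq e s"
  by (auto simp: trunc_sq_def)

lemma trunc_sq_le_1: "e \<le> 1 \<Longrightarrow> \<bar>s\<bar> \<le> 1 \<Longrightarrow> trunc_sq e s \<le> 1"
  by (simp add: trunc_sq_def abs_square_le_1)

lemma continuous_on_ln_trunc_sq:
  assumes "e > 0" shows "continuous_on S (\<lambda>x::nat\<Rightarrow>real. ln (trunc_sq e (x i)))"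
proof -
  have "continuous_on S (\<lambda>x::nat\<Rightarrow>real. trunc_sq e (x i))"
    unfolding trunc_sq_def by (intro continuous_on_max continuous_on_power continuous_on_nth continuous_on_const)
  then show ?thesis using trunc_sq_pos[OF assms] by (intro continuous_on_ln) (auto simp: less_imp_neq[symmetric])
qed

lemma quad_form_le:
  "quad_form A m w \<le> (\<Sum>i\<le>m. \<Sum>j\<le>m. \<bar>A i j\<bar>) * (\<Sum>i\<le>m. (w i)\<^sup>2)"
proof -
  let ?s = "\<Sum>i\<le>m. (w i)\<^sup>2"
  have le: "\<bar>w i\<bar> * \<bar>w j\<bar> \<le> ?s" if "i \<le> m" "j \<le> m" for i j
  proof -
    have "(w i)\<^sup>2 \<le> ?s" "(w j)\<^sup>2 \<le> ?s" using that by (auto intro!: member_le_sum)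
    moreover have "2 * (\<bar>w i\<bar> * \<bar>w j\<bar>) \<le> (w i)\<^sup>2 + (w j)\<^sup>2"
      using sum_squares_bound[of "\<bar>w i\<bar>" "\<bar>w j\<bar>"] by simp
    ultimately show ?thesis by linarith
  qed
  have "A i j * w i * w j \<le> \<bar>A i j\<bar> * ?s" if "i \<le> m" "j \<le> m" for i j
  proof -
    have "A i j * w i * w j \<le> \<bar>A i j\<bar> * (\<bar>w i\<bar> * \<bar>w j\<bar>)"
      by (metis abs_ge_self abs_mult mult.assoc)
    also have "\<dots> \<le> \<bar>A i j\<bar> * ?s" using le[OF that] by (intro mult_left_mono) auto
    finally show ?thesis .
  qed
  then have "quad_form A m w \<le> (\<Sum>i\<le>m. \<Sum>j\<le>m. \<bar>A i j\<bar> * ?s)"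
    unfolding quad_form_def by (intro sum_mono) auto
  then show ?thesis by (simp add: sum_distrib_right)
qed

lemma quad_form_diff:
  assumes sym: "\<And>i j. A i j = A j i"
  shows "quad_form A m (\<lambda>i. x i - y i) = quad_form A m x - quad_form A m y - 2 * (\<Sum>i\<le>m. (\<Sum>j\<le>m. A i j * y j) * (x i - y i))"
proof -
  have sw: "(\<Sum>i\<le>m. \<Sum>j\<le>m. A i j * x i * y j) = (\<Sum>i\<le>m. \<Sum>j\<le>m. A i j * y i * x j)"
    by (subst sum.swap) (simp add: sym[symmetric] mult_ac)
  have "quad_form A m (\<lambda>i. x i - y i) = quad_form A m x - (\<Sum>i\<le>m. \<Sum>j\<le>m. A i j * x i * y j)
      - (\<Sum>i\<le>m. \<Sum>j\<le>m. A i j * y i * x j) + quad_form A m y"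
    by (simp add: quad_form_def algebra_simps sum.distrib sum_subtractf)
  moreover have "(\<Sum>i\<le>m. (\<Sum>j\<le>m. A i j * y j) * (x i - y i)) = (\<Sum>i\<le>m. \<Sum>j\<le>m. A i j * x i * y j) - quad_form A m y"
    by (simp add: quad_form_def sum_distrib_right algebra_simps sum_subtractf sum_distrib_left)
  ultimately show ?thesis using sw by simp
qed

lemma lin_op_inner:
  "(\<Sum>i\<le>m. lin_op A m e C w i * w i) = C * (\<Sum>i\<le>m. (w i)\<^sup>2) - quad_form A m w + (\<Sum>i\<le>m. (w i)\<^sup>2 * ln (trunc_sq e (w i)))"
  by (simp add: lin_op_def quad_form_def algebra_simps sum.distrib sum_subtractf sum_distrib_left power2_eq_square)

text \<open>The truncation bounds the diagonal term from below by \<open>ln e\<close>; hence a large constant \<open>C\<close> makes the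
  linear operator frozen at \<open>w\<close> positive definite. Its lower bound \<open>1\<close> keeps the descent map away from
  the origin.\<close>
lemma lin_op_coercive:
  assumes e: "0 < e" and C: "C \<ge> 1 + (\<Sum>i\<le>m. \<Sum>j\<le>m. \<bar>A i j\<bar>) - ln e"
  shows "(\<Sum>i\<le>m. (x i)\<^sup>2) \<le> C * (\<Sum>i\<le>m. (x i)\<^sup>2) - quad_form A m x + (\<Sum>i\<le>m. (x i)\<^sup>2 * ln (trunc_sq e (w i)))"
proof -
  let ?s = "\<Sum>i\<le>m. (x i)\<^sup>2"
  have s0: "?s \<ge> 0" by (simp add: sum_nonneg)
  have "ln e \<le> ln (trunc_sq e s)" for s using e trunc_sq_pos[OF e, of s] by (simp add: trunc_sq_def)
  then have "(\<Sum>i\<le>m. (x i)\<^sup>2 * ln e) \<le> (\<Sum>i\<le>m. (x i)\<^sup>2 * ln (trunc_sq e (w i)))"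
    by (intro sum_mono mult_left_mono) auto
  then have 1: "?s * ln e \<le> (\<Sum>i\<le>m. (x i)\<^sup>2 * ln (trunc_sq e (w i)))" by (simp add: sum_distrib_right)
  have "(1 + (\<Sum>i\<le>m. \<Sum>j\<le>m. \<bar>A i j\<bar>) - ln e) * ?s \<le> C * ?s"
    using C s0 by (intro mult_right_mono)
  then show ?thesis using 1 quad_form_le[of A m x] by (simp add: algebra_simps)
qed

text \<open>Passing from \<open>w\<close> to \<open>x\<close>, the entropy is controlled by its tangent in \<open>w\<^sup>2\<close>
  (\<open>truncated_entropy_tangent\<close>), which turns the energy difference into a difference of quadratic forms. The
  operator of that form being positive definite, the difference is at most its linear part at \<open>w\<close>.
  Choosing \<open>x\<close> in the direction of the gradient makes the linear part largest.\<close>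
lemma trunc_energy_step:
  assumes sym: "\<And>i j. A i j = A j i"
    and e: "0 < e" and C: "C \<ge> 1 + (\<Sum>i\<le>m. \<Sum>j\<le>m. \<bar>A i j\<bar>) - ln e"
    and x: "(\<Sum>i\<le>m. (x i)\<^sup>2) = 1" and w: "(\<Sum>i\<le>m. (w i)\<^sup>2) = 1"
  shows "trunc_energy A m e x \<le> trunc_energy A m e w - 2 * (\<Sum>i\<le>m. lin_op A m e C w i * (x i - w i))"
proof -
  let ?l = "\<lambda>i. ln (trunc_sq e (w i))"
  have "?l i * ((x i)\<^sup>2 - (w i)\<^sup>2) \<le>
      ((x i)\<^sup>2 * ln (trunc_sq e (x i)) - trunc_sq e (x i) + e) - ((w i)\<^sup>2 * ?l i - trunc_sq e (w i) + e)" for i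
    using truncated_entropy_tangent[OF e, of "(w i)\<^sup>2" "(x i)\<^sup>2"] by (simp add: trunc_sq_def)
  then have "(\<Sum>i\<le>m. ?l i * ((x i)\<^sup>2 - (w i)\<^sup>2)) \<le>
      (\<Sum>i\<le>m. ((x i)\<^sup>2 * ln (trunc_sq e (x i)) - trunc_sq e (x i) + e) - ((w i)\<^sup>2 * ?l i - trunc_sq e (w i) + e))"
    by (intro sum_mono)
  then have 1: "trunc_energy A m e x - trunc_energy A m e w \<le> quad_form A m x - quad_form A m w - (\<Sum>i\<le>m. ?l i * ((x i)\<^sup>2 - (w i)\<^sup>2))"
    unfolding trunc_energy_def by (simp only: sum_subtractf)
  let ?y = "\<lambda>i. x i - w i"
  have 2: "0 \<le> C * (\<Sum>i\<le>m. (?y i)\<^sup>2) - quad_form A m ?y + (\<Sum>i\<le>m. (?y i)\<^sup>2 * ?l i)"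
    by (rule order_trans[OF _ lin_op_coercive[OF e C, of ?y w]]) (simp add: sum_nonneg)
  have "(\<Sum>i\<le>m. lin_op A m e C w i * ?y i)
      = C * (\<Sum>i\<le>m. w i * ?y i) - (\<Sum>i\<le>m. (\<Sum>j\<le>m. A i j * w j) * ?y i) + (\<Sum>i\<le>m. ?l i * (w i * ?y i))"
    by (simp add: lin_op_def algebra_simps sum.distrib sum_subtractf sum_distrib_left)
  moreover have "(\<Sum>i\<le>m. (?y i)\<^sup>2) + 2 * (\<Sum>i\<le>m. w i * ?y i) = (\<Sum>i\<le>m. (x i)\<^sup>2) - (\<Sum>i\<le>m. (w i)\<^sup>2)"
    by (simp add: sum_distrib_left flip: sum.distrib sum_subtractf) (simp add: power2_eq_square algebra_simps)
  moreover have "(\<Sum>i\<le>m. (?y i)\<^sup>2 * ?l i) + 2 * (\<Sum>i\<le>m. ?l i * (w i * ?y i)) = (\<Sum>i\<le>m. ?l i * ((x i)\<^sup>2 - (w i)\<^sup>2))"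
    by (simp add: sum_distrib_left flip: sum.distrib) (simp add: power2_eq_square algebra_simps)
  moreover note quad_form_diff[of A m x w, OF sym]
  moreover have "C * (\<Sum>i\<le>m. (?y i)\<^sup>2) = - (2 * (C * (\<Sum>i\<le>m. w i * ?y i)))"
  proof -
    have "(\<Sum>i\<le>m. (?y i)\<^sup>2) = - (2 * (\<Sum>i\<le>m. w i * ?y i))" using calculation(2) x w by linarith
    then show ?thesis by simp
  qed
  ultimately show ?thesis using 1 2 by linarith
qed


lemma entropy_term_le:
  assumes e: "0 < e" and s: "\<bar>s\<bar> \<le> 1"
  shows "- (s\<^sup>2 * ln (trunc_sq e s)) \<le> 1"
proof (cases "s = 0")
  case False
  then have s2: "s\<^sup>2 > 0" by simp
  have "ln (s\<^sup>2) \<le> ln (trunc_sq e s)" using s2 trunc_sq_pos[OF e, of s] by (simp add: trunc_sq_def)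
  moreover have "- ln (s\<^sup>2) \<le> 1 / s\<^sup>2 - 1"
    using ln_le_minus_one[of "1 / s\<^sup>2"] s2 by (simp add: ln_div)
  ultimately have "s\<^sup>2 * (- ln (trunc_sq e s)) \<le> s\<^sup>2 * (1 / s\<^sup>2 - 1)"
    using s2 by (intro mult_left_mono) auto
  also have "\<dots> \<le> 1" using s2 by (simp add: right_diff_distrib)
  finally show ?thesis by simp
qed simp

lemma trunc_energy_decomp:
  "trunc_energy A m e w = quad_form A m w + (\<Sum>i\<le>m. - ((w i)\<^sup>2 * ln (trunc_sq e (w i)))) + (\<Sum>i\<le>m. trunc_sq e (w i) - e)"
  by (simp add: trunc_energy_def sum.distrib sum_subtractf sum_negf)

lemma trunc_energy_parts:
  assumes e: "0 < e" "e \<le> 1" and w: "w \<in> Sph m"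
  shows "0 \<le> (\<Sum>i\<le>m. - ((w i)\<^sup>2 * ln (trunc_sq e (w i))))"
    "0 \<le> (\<Sum>i\<le>m. trunc_sq e (w i) - e)" "(\<Sum>i\<le>m. trunc_sq e (w i) - e) \<le> 1"
proof -
  have "ln (trunc_sq e (w i)) \<le> 0" for i
    using trunc_sq_le_1[OF e(2) abs_coord_le_1[OF w]] trunc_sq_pos[OF e(1), of "w i"] by simp
  then show "0 \<le> (\<Sum>i\<le>m. - ((w i)\<^sup>2 * ln (trunc_sq e (w i))))"
    by (intro sum_nonneg) (simp add: mult_le_0_iff)
  show "0 \<le> (\<Sum>i\<le>m. trunc_sq e (w i) - e)" by (intro sum_nonneg) (simp add: trunc_sq_def)
  have "(\<Sum>i\<le>m. trunc_sq e (w i) - e) \<le> (\<Sum>i\<le>m. (w i)\<^sup>2)"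
    using e(1) by (intro sum_mono) (simp add: trunc_sq_def max_def)
  then show "(\<Sum>i\<le>m. trunc_sq e (w i) - e) \<le> 1" using w by (simp add: Sph_sum)
qed

text \<open>The descent map \<open>T w\<close> is the normalised gradient. It leaves the energy unchanged only if equality
  holds in the Cauchy-Schwarz inequality between the gradient and \<open>w\<close>, which is the Euler-Lagrange
  equation on the sphere. The multiplier then differs from the energy by the sum of the terms
  \<open>max w\<^sup>2 e - e\<close>, which lies between \<open>0\<close> and \<open>1\<close>; this is why the minimax is run above the level
  \<open>K + 1\<close>. The bound \<open>M\<close> is independent of \<open>m\<close> and \<open>e\<close>.\<close>
lemma truncated_problem_solvable:
  assumes sym: "\<And>i j. A i j = A j i"
    and lower: "\<And>m w. (\<Sum>i\<le>m. v i * (w i)\<^sup>2) \<le> quad_form A m w"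
    and n: "\<And>i. i \<ge> n \<Longrightarrow> K + 1 < v i" and nm: "n \<le> m" and e: "0 < e" "e \<le> 1"
    and M: "M = (\<Sum>i\<le>n. \<Sum>j\<le>n. \<bar>A i j\<bar>) + real n + 2"
  shows "\<exists>w\<in>Sph m. \<exists>lam. K \<le> lam \<and> lam \<le> M \<and> quad_form A m w \<le> M \<and>
    (\<Sum>i\<le>m. - ((w i)\<^sup>2 * ln (trunc_sq e (w i)))) \<le> M - quad_form A m w \<and>
    (\<forall>i\<le>m. (\<Sum>j\<le>m. A i j * w j) = w i * ln (trunc_sq e (w i)) + lam * w i)"
proof -
  define C where "C = 1 + (\<Sum>i\<le>m. \<Sum>j\<le>m. \<bar>A i j\<bar>) - ln e"
  let ?B = "lin_op A m e C"
  let ?F = "trunc_energy A m e"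
  define T where "T w = normalized m (?B w)" for w
  have pos: "1 \<le> (\<Sum>i\<le>m. ?B w i * w i)" if "w \<in> Sph m" for w
    using lin_op_coercive[OF e(1), where x = w and w = w and A = A and m = m and C = C] that
    unfolding lin_op_inner by (simp add: C_def Sph_sum)
  have nz: "\<exists>i\<le>m. ?B w i \<noteq> 0" if "w \<in> Sph m" for w
  proof (rule ccontr)
    assume "\<not> (\<exists>i\<le>m. ?B w i \<noteq> 0)"
    then have "(\<Sum>i\<le>m. ?B w i * w i) = 0" by (intro sum.neutral) auto
    then show False using pos[OF that] by simp
  qed
  have Bc: "continuous_on (Sph m) ?B"
  proof (rule continuous_on_coordinatewise_then_product)
    show "continuous_on (Sph m) (\<lambda>w. ?B w i)" for i unfolding lin_op_def
      by (intro continuous_on_add continuous_on_diff continuous_on_mult continuous_on_sum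
          continuous_on_const continuous_on_nth continuous_on_ln_trunc_sq[OF e(1)])
  qed
  have Tc: "continuous_on (Sph m) T" unfolding T_def
    by (rule continuous_on_normalized[OF Bc]) (use nz in blast)
  have TS: "T w \<in> Sph m" if "w \<in> Sph m" for w
    using nz[OF that] normalized_in_Sph unfolding T_def by blast
  have Fc: "continuous_on (Sph m) ?F"
  proof -
    have "continuous_on (Sph m) (\<lambda>x. trunc_sq e (x i))" for i
      unfolding trunc_sq_def by (intro continuous_on_max continuous_on_power continuous_on_nth continuous_on_const)
    then show ?thesis unfolding trunc_energy_def quad_form_def
      by (intro continuous_on_add continuous_on_diff continuous_on_mult continuous_on_sum continuous_on_power
          continuous_on_const continuous_on_nth continuous_on_ln_trunc_sq[OF e(1)])
  qed
  have Todd: "T (- w) = - T w" for w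
  proof -
    have "?B (- w) = - ?B w" by (auto simp: lin_op_def trunc_sq_uminus sum_negf fun_eq_iff)
    then show ?thesis by (simp add: T_def normalized_uminus)
  qed
  have BT: "(\<Sum>i\<le>m. ?B w i * T w i) = L2_set (?B w) {..m}" if w: "w \<in> Sph m" for w
  proof -
    let ?b = "L2_set (?B w) {..m}"
    have b: "?b > 0" using nz[OF w] L2_set_pos by blast
    have "(\<Sum>i\<le>m. ?B w i * T w i) = (\<Sum>i\<le>m. (?B w i)\<^sup>2) / ?b"
      by (simp add: T_def normalized_def power2_eq_square sum_divide_distrib)
    also have "(\<Sum>i\<le>m. (?B w i)\<^sup>2) = ?b\<^sup>2" by (simp add: L2_set_def sum_nonneg)
    finally show ?thesis using b by (simp add: power2_eq_square)
  qed
  have step: "?F (T w) \<le> ?F w - 2 * (L2_set (?B w) {..m} - (\<Sum>i\<le>m. ?B w i * w i))" if w: "w \<in> Sph m" for w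
    using trunc_energy_step[where A = A and m = m and e = e and C = C and x = "T w" and w = w, OF sym e(1)] BT[OF w] Sph_sum[OF w] Sph_sum[OF TS[OF w]]
    by (simp add: C_def right_diff_distrib sum_subtractf)
  \<comment> \<open>Cauchy-Schwarz together with its equality case.\<close>
  have defect: "(\<Sum>i\<le>m. (?B w i - L2_set (?B w) {..m} * w i)\<^sup>2)
      = 2 * L2_set (?B w) {..m} * (L2_set (?B w) {..m} - (\<Sum>i\<le>m. ?B w i * w i))" if w: "w \<in> Sph m" for w
  proof -
    let ?b = "L2_set (?B w) {..m}"
    have "(\<Sum>i\<le>m. (?B w i - ?b * w i)\<^sup>2)
        = (\<Sum>i\<le>m. (?B w i)\<^sup>2) - 2 * ?b * (\<Sum>i\<le>m. ?B w i * w i) + ?b\<^sup>2 * (\<Sum>i\<le>m. (w i)\<^sup>2)"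
      by (simp add: power2_diff power_mult_distrib sum.distrib sum_subtractf sum_distrib_left sum_distrib_right mult_ac)
    also have "(\<Sum>i\<le>m. (?B w i)\<^sup>2) = ?b\<^sup>2" by (simp add: L2_set_def sum_nonneg)
    finally show ?thesis using Sph_sum[OF w] by (simp add: algebra_simps power2_eq_square)
  qed
  have bpos: "L2_set (?B w) {..m} > 0" if "w \<in> Sph m" for w
    using nz[OF that] L2_set_pos by blast
  have cs: "(\<Sum>i\<le>m. ?B w i * w i) \<le> L2_set (?B w) {..m}" if w: "w \<in> Sph m" for w
  proof -
    have "0 \<le> 2 * L2_set (?B w) {..m} * (L2_set (?B w) {..m} - (\<Sum>i\<le>m. ?B w i * w i))"
      unfolding defect[OF w, symmetric] by (simp add: sum_nonneg)
    then show ?thesis using bpos[OF w] by (simp add: zero_le_mult_iff)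
  qed
  have "\<exists>x\<in>Sph m. ?F (T x) = ?F x \<and> K + 1 \<le> ?F x \<and> ?F x \<le> M"
  proof (rule odd_descent_almost_critical_point[OF nm Fc Tc TS Todd])
    show "?F (T x) \<le> ?F x" if "x \<in> Sph m" for x using step[OF that] cs[OF that] by simp
    show "?F x \<le> M" if x: "x \<in> Sph n" for x
    proof -
      have x0: "x i = 0" if "i > n" for i using x that by (simp add: Sph_iff)
      have xm: "x \<in> Sph m" using x Sph_mono[OF nm] by blast
      have "quad_form A m x = (\<Sum>i\<le>n. \<Sum>j\<le>m. A i j * x i * x j)"
        unfolding quad_form_def using nm x0 by (intro sum.mono_neutral_right) auto
      also have "\<dots> = quad_form A n x"
        unfolding quad_form_def using nm x0 by (intro sum.cong refl sum.mono_neutral_right) auto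
      also have "\<dots> \<le> (\<Sum>i\<le>n. \<Sum>j\<le>n. \<bar>A i j\<bar>)" using quad_form_le[of A n x] Sph_sum[OF x] by simp
      finally have 1: "quad_form A m x \<le> (\<Sum>i\<le>n. \<Sum>j\<le>n. \<bar>A i j\<bar>)" .
      have "(\<Sum>i\<le>m. - ((x i)\<^sup>2 * ln (trunc_sq e (x i)))) = (\<Sum>i\<le>n. - ((x i)\<^sup>2 * ln (trunc_sq e (x i))))"
        using nm x0 by (intro sum.mono_neutral_right) auto
      also have "\<dots> \<le> (\<Sum>i\<le>n. 1)"
        by (intro sum_mono entropy_term_le[OF e(1)] abs_coord_le_1[OF x])
      finally show ?thesis using 1 trunc_energy_parts(3)[OF e xm] by (simp add: trunc_energy_decomp M)
    qed
    show "K + 1 < ?F x" if x: "x \<in> Sph m" and x0: "\<forall>i<n. x i = 0" for x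
    proof -
      obtain k where k: "k \<le> m" "x k \<noteq> 0"
      proof -
        have "(\<Sum>i\<le>m. (x i)\<^sup>2) \<noteq> 0" using Sph_sum[OF x] by simp
        then obtain k where "k \<in> {..m}" "(x k)\<^sup>2 \<noteq> 0" by (rule sum.not_neutral_contains_not_neutral)
        then show thesis using that by simp
      qed
      have "(\<Sum>i\<le>m. (K + 1) * (x i)\<^sup>2) < (\<Sum>i\<le>m. v i * (x i)\<^sup>2)"
      proof (rule sum_strict_mono_ex1)
        show "\<forall>i\<in>{..m}. (K + 1) * (x i)\<^sup>2 \<le> v i * (x i)\<^sup>2"
        proof
          fix i show "(K + 1) * (x i)\<^sup>2 \<le> v i * (x i)\<^sup>2"
            using x0 n[of i] by (cases "i < n") (auto intro!: mult_right_mono)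
        qed
        have "k \<ge> n" using x0 k by (metis not_le)
        then show "\<exists>i\<in>{..m}. (K + 1) * (x i)\<^sup>2 < v i * (x i)\<^sup>2"
          using k n by (intro bexI[of _ k]) auto
      qed simp
      moreover have "(\<Sum>i\<le>m. (K + 1) * (x i)\<^sup>2) = K + 1"
        using Sph_sum[OF x] by (simp flip: sum_distrib_left)
      ultimately show ?thesis
        using lower[where m = m and w = x] trunc_energy_parts(1,2)[OF e x] by (simp add: trunc_energy_decomp)
    qed
  qed
  then obtain w where w: "w \<in> Sph m" and fix_: "?F (T w) = ?F w" and FK: "K + 1 \<le> ?F w" "?F w \<le> M"
    by blast
  define b where "b = L2_set (?B w) {..m}"
  have "L2_set (?B w) {..m} = (\<Sum>i\<le>m. ?B w i * w i)"
    using step[OF w] cs[OF w] unfolding fix_ by simp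
  then have "(\<Sum>i\<le>m. (?B w i - b * w i)\<^sup>2) = 0" using defect[OF w] by (simp add: b_def)
  then have Bw: "?B w i = b * w i" if "i \<le> m" for i
    using that by (simp add: sum_nonneg_eq_0_iff)
  define lam where "lam = C - b"
  have eq: "(\<Sum>j\<le>m. A i j * w j) = w i * ln (trunc_sq e (w i)) + lam * w i" if "i \<le> m" for i
    using Bw[OF that] by (simp add: lin_op_def lam_def algebra_simps)
  have "b = (\<Sum>i\<le>m. ?B w i * w i)" using Bw Sph_sum[OF w]
    by (simp add: power2_eq_square mult.assoc flip: sum_distrib_left)
  then have "lam = quad_form A m w + (\<Sum>i\<le>m. - ((w i)\<^sup>2 * ln (trunc_sq e (w i))))"
    unfolding lin_op_inner using Sph_sum[OF w] by (simp add: lam_def sum_negf)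
  then have FL: "?F w = lam + (\<Sum>i\<le>m. trunc_sq e (w i) - e)" by (simp add: trunc_energy_decomp)
  note parts = trunc_energy_parts[OF e w]
  show ?thesis
  proof (intro bexI[OF _ w] exI[of _ lam] conjI allI impI)
    show "K \<le> lam" "lam \<le> M" using FL FK parts by linarith+
    show "quad_form A m w \<le> M" using FK parts by (simp add: trunc_energy_decomp)
    show "(\<Sum>i\<le>m. - ((w i)\<^sup>2 * ln (trunc_sq e (w i)))) \<le> M - quad_form A m w"
      using FK parts unfolding trunc_energy_decomp by linarith
  qed (use eq in blast)
qed

section \<open>Removing the truncation\<close>
lemma tendsto_truncated_log:
  assumes s: "s \<longlonglongrightarrow> l" and e: "e \<longlonglongrightarrow> 0" and epos: "\<And>n. 0 < e n"
  shows "(\<lambda>n. s n * ln (trunc_sq (e n) (s n))) \<longlonglongrightarrow> l * ln (l\<^sup>2)"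
proof -
  have t: "(\<lambda>n. trunc_sq (e n) (s n)) \<longlonglongrightarrow> l\<^sup>2"
    unfolding trunc_sq_def using tendsto_max[OF tendsto_power[OF s, of 2] e] by simp
  show ?thesis
  proof (cases "l = 0")
    case False
    then show ?thesis by (intro tendsto_mult s tendsto_ln t) auto
  next
    case True
    have "filterlim (\<lambda>n. trunc_sq (e n) (s n)) (at_right 0) sequentially"
      using t True trunc_sq_pos[OF epos] by (simp add: tendsto_imp_filterlim_at_right)
    moreover have "((\<lambda>x::real. sqrt x * ln x) \<longlongrightarrow> 0) (at_right 0)" by real_asymp
    ultimately have lim: "(\<lambda>n. sqrt (trunc_sq (e n) (s n)) * ln (trunc_sq (e n) (s n))) \<longlonglongrightarrow> 0"
      by (rule filterlim_compose[rotated])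
    \<comment> \<open>With \<open>m = max s\<^sup>2 e\<close> the product is dominated by \<open>sqrt m * ln m\<close>, however \<open>s\<close> and \<open>e\<close> compare.\<close>
    have "\<bar>s n\<bar> \<le> sqrt (trunc_sq (e n) (s n))" for n
      by (simp add: trunc_sq_def real_le_rsqrt)
    then have "norm (s n * ln (trunc_sq (e n) (s n))) \<le> norm (sqrt (trunc_sq (e n) (s n)) * ln (trunc_sq (e n) (s n)))" for n
      using trunc_sq_pos[OF epos, of n "s n"] by (simp add: abs_mult mult_right_mono)
    then have "(\<lambda>n. s n * ln (trunc_sq (e n) (s n))) \<longlonglongrightarrow> 0"
      by (intro Lim_null_comparison[OF always_eventually tendsto_norm_zero[OF lim]]) blast
    then show ?thesis using True by simp
  qed
qed

text \<open>Solutions of the truncated problems on the first \<open>n + N + 1\<close> coordinates with truncation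
  \<open>1 / (N + 1)\<close> have coordinates in \<open>[-1, 1]\<close> and multipliers in \<open>[K, M]\<close>, so a subsequence converges
  coordinatewise. The matrix has finite rows, so each single equation passes to the limit. The sums
  \<open>\<Sum>(v i + 1) * (w i)\<^sup>2\<close> and \<open>-\<Sum>(w i)\<^sup>2 ln (w i)\<^sup>2\<close> have nonnegative terms and are bounded along
  the sequence, hence also for the limit. Since \<open>v\<close> tends to infinity, the first bound makes the tails
  of \<open>\<Sum>(w i)\<^sup>2\<close> uniformly small, so the limit still has norm \<open>1\<close>.\<close>
theorem log_nonlinear_eigenvector:
  fixes A :: "nat \<Rightarrow> nat \<Rightarrow> real" and v :: "nat \<Rightarrow> real" and K :: real
  assumes sym: "\<And>i j. A i j = A j i" and rf: "\<And>i. finite {j. A i j \<noteq> 0}"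
    and lower: "\<And>m w. (\<Sum>i\<le>m. v i * (w i)\<^sup>2) \<le> quad_form A m w"
    and v1: "\<And>i. - 1 \<le> v i" and vlim: "filterlim v at_top sequentially"
  shows "\<exists>w lam. K \<le> lam \<and> (\<lambda>i. (w i)\<^sup>2) sums 1 \<and> summable (\<lambda>i. (v i + 1) * (w i)\<^sup>2) \<and>
    summable (\<lambda>i. (w i)\<^sup>2 * ln ((w i)\<^sup>2)) \<and>
    (\<forall>i. (\<Sum>j | A i j \<noteq> 0. A i j * w j) = w i * ln ((w i)\<^sup>2) + lam * w i)"
proof -
  obtain n where n: "\<And>i. i \<ge> n \<Longrightarrow> K + 1 < v i"
    using filterlim_at_top_dense[THEN iffD1, OF vlim] unfolding eventually_sequentially by blast
  define M where "M = (\<Sum>i\<le>n. \<Sum>j\<le>n. \<bar>A i j\<bar>) + real n + 2"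
  define m where "m N = n + N" for N
  define e where "e N = 1 / (real N + 1)" for N
  have e: "0 < e N" "e N \<le> 1" for N by (auto simp: e_def)
  have ex: "\<forall>N. \<exists>W. fst W \<in> Sph (m N) \<and> K \<le> snd W \<and> snd W \<le> M \<and> quad_form A (m N) (fst W) \<le> M \<and>
    (\<Sum>i\<le>m N. - ((fst W i)\<^sup>2 * ln (trunc_sq (e N) (fst W i)))) \<le> M - quad_form A (m N) (fst W) \<and>
    (\<forall>i\<le>m N. (\<Sum>j\<le>m N. A i j * fst W j) = fst W i * ln (trunc_sq (e N) (fst W i)) + snd W * fst W i)"
  proof
    fix N
    have nm: "n \<le> m N" by (simp add: m_def)
    from truncated_problem_solvable[of A v n K, OF sym lower n nm e M_def] obtain w lam where
      "w \<in> Sph (m N)" "K \<le> lam \<and> lam \<le> M \<and> quad_form A (m N) w \<le> M \<and>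
       (\<Sum>i\<le>m N. - ((w i)\<^sup>2 * ln (trunc_sq (e N) (w i)))) \<le> M - quad_form A (m N) w \<and>
       (\<forall>i\<le>m N. (\<Sum>j\<le>m N. A i j * w j) = w i * ln (trunc_sq (e N) (w i)) + lam * w i)" by blast
    then show "\<exists>W. fst W \<in> Sph (m N) \<and> K \<le> snd W \<and> snd W \<le> M \<and> quad_form A (m N) (fst W) \<le> M \<and>
      (\<Sum>i\<le>m N. - ((fst W i)\<^sup>2 * ln (trunc_sq (e N) (fst W i)))) \<le> M - quad_form A (m N) (fst W) \<and>
      (\<forall>i\<le>m N. (\<Sum>j\<le>m N. A i j * fst W j) = fst W i * ln (trunc_sq (e N) (fst W i)) + snd W * fst W i)"
      by (intro exI[of _ "(w, lam)"]) simp
  qed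
  obtain WL where WL: "\<forall>N. fst (WL N) \<in> Sph (m N) \<and> K \<le> snd (WL N) \<and> snd (WL N) \<le> M \<and> quad_form A (m N) (fst (WL N)) \<le> M \<and>
    (\<Sum>i\<le>m N. - ((fst (WL N) i)\<^sup>2 * ln (trunc_sq (e N) (fst (WL N) i)))) \<le> M - quad_form A (m N) (fst (WL N)) \<and>
    (\<forall>i\<le>m N. (\<Sum>j\<le>m N. A i j * fst (WL N) j) = fst (WL N) i * ln (trunc_sq (e N) (fst (WL N) i)) + snd (WL N) * fst (WL N) i)"
    by (rule exE[OF choice[OF ex]])
  define W where "W N = fst (WL N)" for N
  define l where "l N = snd (WL N)" for N
  have WS: "W N \<in> Sph (m N)" and l: "l N \<in> {K..M}" and q: "quad_form A (m N) (W N) \<le> M"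
    and ent: "(\<Sum>i\<le>m N. - ((W N i)\<^sup>2 * ln (trunc_sq (e N) (W N i)))) \<le> M - quad_form A (m N) (W N)"
    and eq: "\<And>i. i \<le> m N \<Longrightarrow> (\<Sum>j\<le>m N. A i j * W N j) = W N i * ln (trunc_sq (e N) (W N i)) + l N * W N i" for N
    using WL unfolding W_def l_def by auto
  note W1 = abs_coord_le_1[OF WS]
  let ?box = "PiE UNIV (\<lambda>i::nat. {-1..1::real})"
  have "compactin (powertop_real UNIV) ?box"
    by (subst compactin_PiE) auto
  then have "seq_compact ?box"
    by (simp add: euclidean_product_topology compact_imp_seq_compact)
  moreover have "\<forall>N. W N \<in> ?box" using W1 by (auto simp: abs_le_iff minus_le_iff)
  ultimately obtain w r1 where r1: "strict_mono (r1 :: nat \<Rightarrow> nat)" and lim1: "(W \<circ> r1) \<longlonglongrightarrow> w"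
    unfolding seq_compact_def by blast
  have "seq_compact {K..M}" by (simp add: compact_imp_seq_compact)
  moreover have "\<forall>N. (l \<circ> r1) N \<in> {K..M}" using l by simp
  ultimately obtain lam r2 where lam: "lam \<in> {K..M}" and r2: "strict_mono (r2 :: nat \<Rightarrow> nat)"
    and lim2: "((l \<circ> r1) \<circ> r2) \<longlonglongrightarrow> lam"
    unfolding seq_compact_def by blast
  define r where "r = r1 \<circ> r2"
  have r: "strict_mono r" unfolding r_def by (rule strict_mono_o[OF r1 r2])
  have ll: "(\<lambda>N. l (r N)) \<longlonglongrightarrow> lam" using lim2 by (simp add: r_def o_def)
  have "(\<lambda>N. W (r N)) \<longlonglongrightarrow> w"
    using LIMSEQ_subseq_LIMSEQ[OF lim1 r2] by (simp add: r_def o_def)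
  then have wl: "(\<lambda>N. W (r N) i) \<longlonglongrightarrow> w i" for i
    using continuous_on_tendsto_compose[OF continuous_on_nth[of UNIV i], of "\<lambda>N. W (r N)" w] by simp
  have el: "(\<lambda>N. e (r N)) \<longlonglongrightarrow> 0"
  proof -
    have "e \<longlonglongrightarrow> 0" unfolding e_def by real_asymp
    then show ?thesis using LIMSEQ_subseq_LIMSEQ[OF _ r, of e 0] by (simp add: o_def)
  qed
  have big: "eventually (\<lambda>N. k \<le> m (r N)) sequentially" for k
    using seq_suble[OF r] by (auto simp: m_def eventually_sequentially intro!: exI[of _ k] intro: order_trans trans_le_add2)
  have w2l: "(\<lambda>N. (W (r N) i)\<^sup>2) \<longlonglongrightarrow> (w i)\<^sup>2" for i by (intro tendsto_power wl)
  have tl: "(\<lambda>N. W (r N) i * ln (trunc_sq (e (r N)) (W (r N) i))) \<longlonglongrightarrow> w i * ln ((w i)\<^sup>2)" for i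
    by (rule tendsto_truncated_log[OF wl el e(1)])
  have v1sum: "(\<Sum>i\<le>m N. (v i + 1) * (W N i)\<^sup>2) \<le> M + 1" for N
    using lower[where m = "m N" and w = "W N"] q[of N] Sph_sum[OF WS, of N] by (simp add: distrib_right sum.distrib)
  have qlow: "- 1 \<le> quad_form A (m N) (W N)" for N
  proof -
    have "(\<Sum>i\<le>m N. (- 1) * (W N i)\<^sup>2) \<le> (\<Sum>i\<le>m N. v i * (W N i)\<^sup>2)"
      using v1 by (intro sum_mono mult_right_mono) auto
    then show ?thesis using lower[where m = "m N" and w = "W N"] Sph_sum[OF WS, of N] by (simp add: sum_negf)
  qed
  have entpos: "0 \<le> - ((W N i)\<^sup>2 * ln (trunc_sq (e N) (W N i)))" for N i
    using trunc_sq_le_1[OF e(2) W1] trunc_sq_pos[OF e(1)] by (simp add: mult_le_0_iff)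
  have M1: "M + 1 \<ge> 0" using q[of 0] qlow[of 0] by linarith
  \<comment> \<open>Fatou's lemma for the partial sums.\<close>
  have bounded_limit: "(\<Sum>i<k. f i) \<le> C"
    if f: "\<And>i. (\<lambda>N. g N i) \<longlonglongrightarrow> f i" and g0: "\<And>N i. 0 \<le> g N i"
      and g: "\<And>N. (\<Sum>i\<le>m (r N). g N i) \<le> C" for f :: "nat \<Rightarrow> real" and g C k
  proof (rule tendsto_upperbound[OF tendsto_sum[OF f]])
    show "eventually (\<lambda>N. (\<Sum>i<k. g N i) \<le> C) sequentially"
      using big[of k]
    proof eventually_elim
      case (elim N)
      have "(\<Sum>i<k. g N i) \<le> (\<Sum>i\<le>m (r N). g N i)" using elim g0 by (intro sum_mono2) auto
      then show ?case using g[of N] by linarith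
    qed
  qed simp
  have s1: "summable (\<lambda>i. (v i + 1) * (w i)\<^sup>2)"
  proof (rule summableI_nonneg_bounded)
    show "0 \<le> (v i + 1) * (w i)\<^sup>2" for i using v1[of i] by simp
    show "(\<Sum>i<k. (v i + 1) * (w i)\<^sup>2) \<le> M + 1" for k
    proof (rule bounded_limit)
      show "(\<lambda>N. (v i + 1) * (W (r N) i)\<^sup>2) \<longlonglongrightarrow> (v i + 1) * (w i)\<^sup>2" for i
        by (intro tendsto_mult tendsto_const w2l)
      show "0 \<le> (v i + 1) * (W (r N) i)\<^sup>2" for N i using v1[of i] by simp
    qed (rule v1sum)
  qed
  have s2: "summable (\<lambda>i. - ((w i)\<^sup>2 * ln ((w i)\<^sup>2)))"
  proof (rule summableI_nonneg_bounded)
    have lim: "(\<lambda>N. - ((W (r N) i)\<^sup>2 * ln (trunc_sq (e (r N)) (W (r N) i)))) \<longlonglongrightarrow> - ((w i)\<^sup>2 * ln ((w i)\<^sup>2))" for i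
      using tendsto_minus[OF tendsto_mult[OF wl[of i] tl[of i]]]
      by (simp add: power2_eq_square mult.assoc)
    show "0 \<le> - ((w i)\<^sup>2 * ln ((w i)\<^sup>2))" for i
      by (rule tendsto_lowerbound[OF lim always_eventually]) (use entpos in auto)
    show "(\<Sum>i<k. - ((w i)\<^sup>2 * ln ((w i)\<^sup>2))) \<le> M + 1" for k
    proof (rule bounded_limit[OF lim entpos])
      show "(\<Sum>i\<le>m (r N). - ((W (r N) i)\<^sup>2 * ln (trunc_sq (e (r N)) (W (r N) i)))) \<le> M + 1" for N
        using ent[of "r N"] qlow[of "r N"] by linarith
    qed
  qed
  have le1: "(\<Sum>i<k. (w i)\<^sup>2) \<le> 1" for k
    by (rule bounded_limit[OF w2l]) (use Sph_sum[OF WS] in auto)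
  have s3: "summable (\<lambda>i. (w i)\<^sup>2)"
    by (rule summableI_nonneg_bounded[OF _ le1]) simp
  have tail: "1 - (M + 1) / R \<le> suminf (\<lambda>i. (w i)\<^sup>2)" if R: "R > 0" for R
  proof -
    obtain p where p: "\<And>i. i \<ge> p \<Longrightarrow> R < v i"
      using filterlim_at_top_dense[THEN iffD1, OF vlim] unfolding eventually_sequentially by blast
    have p': "R \<le> v i + 1" if "p \<le> i" for i using p[OF that] by linarith
    have "1 - (M + 1) / R \<le> (\<Sum>i<p. (W N i)\<^sup>2)" for N
    proof -
      have split: "(\<Sum>i\<le>m N. (W N i)\<^sup>2) = (\<Sum>i\<in>{..m N} \<inter> {..<p}. (W N i)\<^sup>2) + (\<Sum>i\<in>{..m N} - {..<p}. (W N i)\<^sup>2)"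
        by (rule sum.Int_Diff) simp
      have "(\<Sum>i\<in>{..m N} \<inter> {..<p}. (W N i)\<^sup>2) \<le> (\<Sum>i<p. (W N i)\<^sup>2)" by (intro sum_mono2) auto
      moreover have "R * (\<Sum>i\<in>{..m N} - {..<p}. (W N i)\<^sup>2) \<le> M + 1"
      proof -
        have "R * (\<Sum>i\<in>{..m N} - {..<p}. (W N i)\<^sup>2) \<le> (\<Sum>i\<in>{..m N} - {..<p}. (v i + 1) * (W N i)\<^sup>2)"
          unfolding sum_distrib_left using p' by (intro sum_mono mult_right_mono) (auto simp: not_less)
        also have "\<dots> \<le> (\<Sum>i\<le>m N. (v i + 1) * (W N i)\<^sup>2)"
        proof (rule sum_mono2)
          show "0 \<le> (v i + 1) * (W N i)\<^sup>2" for i using v1[of i] by simp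
        qed auto
        finally show ?thesis using v1sum[of N] by linarith
      qed
      then have "(\<Sum>i\<in>{..m N} - {..<p}. (W N i)\<^sup>2) \<le> (M + 1) / R" using R by (simp add: field_simps)
      ultimately show ?thesis using split Sph_sum[OF WS, of N] by linarith
    qed
    then have "1 - (M + 1) / R \<le> (\<Sum>i<p. (w i)\<^sup>2)"
      by (intro tendsto_lowerbound[OF tendsto_sum[OF w2l] always_eventually]) auto
    also have "\<dots> \<le> suminf (\<lambda>i. (w i)\<^sup>2)" by (rule sum_le_suminf[OF s3]) auto
    finally show ?thesis .
  qed
  have "1 \<le> suminf (\<lambda>i. (w i)\<^sup>2)"
  proof (rule field_le_epsilon)
    fix \<epsilon> :: real assume \<epsilon>: "\<epsilon> > 0"
    have "(M + 1) / ((M + 2) / \<epsilon>) \<le> \<epsilon>" using M1 \<epsilon> by (simp add: field_simps)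
    moreover have "(M + 2) / \<epsilon> > 0" using M1 \<epsilon> by simp
    ultimately show "1 \<le> suminf (\<lambda>i. (w i)\<^sup>2) + \<epsilon>" using tail by fastforce
  qed
  moreover have "suminf (\<lambda>i. (w i)\<^sup>2) \<le> 1" by (rule suminf_le_const[OF s3 le1])
  ultimately have sums: "(\<lambda>i. (w i)\<^sup>2) sums 1" using summable_sums[OF s3] by simp
  have weq: "(\<Sum>j | A i j \<noteq> 0. A i j * w j) = w i * ln ((w i)\<^sup>2) + lam * w i" for i
  proof (rule LIMSEQ_unique)
    show "(\<lambda>N. \<Sum>j | A i j \<noteq> 0. A i j * W (r N) j) \<longlonglongrightarrow> (\<Sum>j | A i j \<noteq> 0. A i j * w j)"
      by (intro tendsto_sum tendsto_mult tendsto_const wl)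
    obtain k where k: "\<And>j. A i j \<noteq> 0 \<Longrightarrow> j \<le> k"
      using rf[of i] finite_nat_set_iff_bounded_le[of "{j. A i j \<noteq> 0}"] by blast
    have ev: "eventually (\<lambda>N. W (r N) i * ln (trunc_sq (e (r N)) (W (r N) i)) + l (r N) * W (r N) i =
       (\<Sum>j | A i j \<noteq> 0. A i j * W (r N) j)) sequentially"
      using big[of "max i k"]
    proof eventually_elim
      case (elim N)
      have "(\<Sum>j\<le>m (r N). A i j * W (r N) j) = (\<Sum>j | A i j \<noteq> 0. A i j * W (r N) j)"
        using k elim by (intro sum.mono_neutral_right) (auto intro: order_trans)
      then show ?case using eq[of i "r N"] elim by simp
    qed
    have "(\<lambda>N. W (r N) i * ln (trunc_sq (e (r N)) (W (r N) i)) + l (r N) * W (r N) i) \<longlonglongrightarrow> w i * ln ((w i)\<^sup>2) + lam * w i"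
      by (intro tendsto_add tendsto_mult tl ll wl)
    then show "(\<lambda>N. \<Sum>j | A i j \<noteq> 0. A i j * W (r N) j) \<longlonglongrightarrow> w i * ln ((w i)\<^sup>2) + lam * w i"
      by (rule Lim_transform_eventually[OF _ ev])
  qed
  have "summable (\<lambda>i. (w i)\<^sup>2 * ln ((w i)\<^sup>2))" using summable_minus[OF s2] by simp
  then show ?thesis
    using lam sums s1 weq by (intro exI[of _ w] exI[of _ lam] conjI allI) auto
qed

section \<open>Summation by parts and energy on graphs of bounded degree\<close>
locale bounded_degree_graph =
  fixes E :: "('v \<times> 'v) set" and C :: nat
  assumes sym_E: "sym E"
    and fin: "\<And>x. finite {y. (x, y) \<in> E}" and card_le: "\<And>x. card {y. (x, y) \<in> E} \<le> C"
begin

abbreviation nbh where "nbh x \<equiv> {y. (x, y) \<in> E}"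

lemma finite_reach: "finite {x. (x, z) \<in> E ^^ k}"
proof (induction k)
  case (Suc k)
  have "{x. (x, z) \<in> E ^^ Suc k} \<subseteq> (\<Union>y\<in>{y. (y, z) \<in> E ^^ k}. nbh y)"
  proof
    fix x assume "x \<in> {x. (x, z) \<in> E ^^ Suc k}"
    then obtain y where "(x, y) \<in> E" "(y, z) \<in> E ^^ k" by (blast dest: relpow_Suc_D2)
    then show "x \<in> (\<Union>y\<in>{y. (y, z) \<in> E ^^ k}. nbh y)" using sym_E by (blast dest: symD)
  qed
  moreover have "finite (\<Union>y\<in>{y. (y, z) \<in> E ^^ k}. nbh y)"
    using Suc fin by blast
  ultimately show ?case by (rule finite_subset)
qed simp

lemma countable_vertices:
  assumes "graph_connected E" shows "countable (UNIV :: 'v set)"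
proof -
  fix z :: 'v
  have "(UNIV :: 'v set) = (\<Union>k. {x. (x, z) \<in> E ^^ k})"
    using assms unfolding graph_connected_def rtrancl_power by auto
  moreover have "countable (\<Union>k. {x. (x, z) \<in> E ^^ k})"
    using finite_reach by (intro countable_UN) (auto intro: countable_finite)
  ultimately show ?thesis by simp
qed

lemma finite_sublevel:
  assumes con: "graph_connected E"
    and V: "filterlim V at_top (filtercomap (\<lambda>x. gdist E x x0) at_top)"
  shows "finite {x. V x \<le> (K :: real)}"
proof -
  have "eventually (\<lambda>x. K < V x) (filtercomap (\<lambda>x. gdist E x x0) at_top)"
    using V unfolding filterlim_at_top_dense by blast
  then obtain n where n: "\<And>x. n \<le> gdist E x x0 \<Longrightarrow> K < V x"
    unfolding eventually_filtercomap eventually_at_top_linorder by metis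
  have "(x, x0) \<in> E ^^ gdist E x x0" for x
  proof -
    have "\<exists>k. (x, x0) \<in> E ^^ k" using con unfolding graph_connected_def by (metis rtrancl_imp_relpow)
    then show ?thesis unfolding gdist_def by (rule LeastI_ex)
  qed
  then have "{x. V x \<le> K} \<subseteq> (\<Union>k\<in>{..<n}. {x. (x, x0) \<in> E ^^ k})"
    using n by (force simp: not_le[symmetric])
  then show ?thesis by (rule finite_subset) (simp add: finite_reach)
qed

text \<open>Double counting: both sides sum \<open>f\<close> over the edges, and each vertex \<open>x\<close> is the endpoint of as many
  edges as it has neighbours.\<close>
lemma nn_integral_sum_nbh:
  fixes f :: "'v \<Rightarrow> ennreal"
  shows "(\<integral>\<^sup>+x. (\<Sum>y\<in>nbh x. f y) \<partial>count_space UNIV) = (\<integral>\<^sup>+x. of_nat (card (nbh x)) * f x \<partial>count_space UNIV)"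
proof -
  let ?h = "\<lambda>(x, y). f y * indicator E (x, y)"
  have 1: "(\<Sum>y\<in>nbh x. f y) = (\<integral>\<^sup>+y. ?h (x, y) \<partial>count_space UNIV)" for x
  proof -
    have "(\<integral>\<^sup>+y. ?h (x, y) \<partial>count_space UNIV) = (\<Sum>y\<in>nbh x. ?h (x, y))"
      using fin[of x] by (intro nn_integral_count_space') (auto simp: indicator_def)
    then show ?thesis by simp
  qed
  have 2: "of_nat (card (nbh y)) * f y = (\<integral>\<^sup>+x. ?h (x, y) \<partial>count_space UNIV)" for y
  proof -
    have "(\<integral>\<^sup>+x. ?h (x, y) \<partial>count_space UNIV) = (\<Sum>x\<in>nbh y. ?h (x, y))"
      using fin[of y] sym_E by (intro nn_integral_count_space') (auto simp: indicator_def dest: symD)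
    also have "\<dots> = (\<Sum>x\<in>nbh y. f y)" using sym_E by (intro sum.cong) (auto dest: symD)
    finally show ?thesis by simp
  qed
  show ?thesis unfolding 1 2
    using nn_integral_fst_count_space[of ?h] nn_integral_snd_count_space[of ?h] by simp
qed

lemma
  fixes g :: "'v \<Rightarrow> real"
  assumes g: "integrable (count_space UNIV) g" and pos: "\<And>x. 0 \<le> g x"
  shows integrable_deg: "integrable (count_space UNIV) (\<lambda>x. real (card (nbh x)) * g x)"
    and integrable_sum_nbh: "integrable (count_space UNIV) (\<lambda>x. \<Sum>y\<in>nbh x. g y)"
    and integral_sum_nbh: "(\<integral>x. (\<Sum>y\<in>nbh x. g y) \<partial>count_space UNIV) = (\<integral>x. real (card (nbh x)) * g x \<partial>count_space UNIV)"
    and integral_deg_le: "(\<integral>x. real (card (nbh x)) * g x \<partial>count_space UNIV) \<le> real C * (\<integral>x. g x \<partial>count_space UNIV)"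
proof -
  have le: "real (card (nbh x)) * g x \<le> real C * g x" for x
    using card_le[of x] pos by (intro mult_right_mono) auto
  have Cg: "integrable (count_space UNIV) (\<lambda>x. real C * g x)" using g by simp
  show d: "integrable (count_space UNIV) (\<lambda>x. real (card (nbh x)) * g x)"
    by (rule Bochner_Integration.integrable_bound[OF Cg]) (use le pos in \<open>auto intro!: AE_I2\<close>)
  have nn: "(\<integral>\<^sup>+x. ennreal (\<Sum>y\<in>nbh x. g y) \<partial>count_space UNIV) = (\<integral>\<^sup>+x. ennreal (real (card (nbh x)) * g x) \<partial>count_space UNIV)"
    using nn_integral_sum_nbh[of "\<lambda>x. ennreal (g x)"] pos by (simp add: sum_ennreal ennreal_mult' ennreal_of_nat_eq_real_of_nat)
  have fin': "(\<integral>\<^sup>+x. ennreal (real (card (nbh x)) * g x) \<partial>count_space UNIV) < \<infinity>"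
    using d pos by (simp add: nn_integral_eq_integral)
  show s: "integrable (count_space UNIV) (\<lambda>x. \<Sum>y\<in>nbh x. g y)"
    using fin' unfolding nn[symmetric] by (intro integrableI_nonneg) (auto simp: sum_nonneg pos)
  have "ennreal (\<integral>x. (\<Sum>y\<in>nbh x. g y) \<partial>count_space UNIV) = ennreal (\<integral>x. real (card (nbh x)) * g x \<partial>count_space UNIV)"
    using nn nn_integral_eq_integral[OF s] nn_integral_eq_integral[OF d] pos by (simp add: sum_nonneg)
  then show "(\<integral>x. (\<Sum>y\<in>nbh x. g y) \<partial>count_space UNIV) = (\<integral>x. real (card (nbh x)) * g x \<partial>count_space UNIV)"
    using pos by (subst (asm) ennreal_inj) (auto intro!: integral_nonneg_AE sum_nonneg)
  show "(\<integral>x. real (card (nbh x)) * g x \<partial>count_space UNIV) \<le> real C * (\<integral>x. g x \<partial>count_space UNIV)"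
    using integral_mono[OF d Cg le] by simp
qed

lemma grad_sq_le: "grad_sq E u x \<le> (\<Sum>y\<in>nbh x. (u y)\<^sup>2) + real (card (nbh x)) * (u x)\<^sup>2"
proof -
  have "(u y - u x)\<^sup>2 \<le> 2 * ((u y)\<^sup>2 + (u x)\<^sup>2)" for y
    using sum_squares_bound[of "u y" "- u x"] by (simp add: power2_diff)
  then have "(\<Sum>y\<in>nbh x. (u y - u x)\<^sup>2) \<le> (\<Sum>y\<in>nbh x. 2 * ((u y)\<^sup>2 + (u x)\<^sup>2))" by (rule sum_mono)
  then show ?thesis by (simp add: grad_sq_def sum.distrib flip: sum_distrib_left)
qed

lemma grad_sq_nonneg: "0 \<le> grad_sq E u x"
  by (simp add: grad_sq_def sum_nonneg)

context
  fixes u :: "'v \<Rightarrow> real"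
  assumes u2: "integrable (count_space UNIV) (\<lambda>x. (u x)\<^sup>2)"
begin

lemma integrable_grad_sq: "integrable (count_space UNIV) (grad_sq E u)"
  by (rule Bochner_Integration.integrable_bound
      [OF Bochner_Integration.integrable_add[OF integrable_sum_nbh[OF u2] integrable_deg[OF u2]]])
    (use grad_sq_le[of u] grad_sq_nonneg[of u] in \<open>auto intro!: AE_I2 intro: order_trans[OF _ abs_ge_self]\<close>)

lemma H1_norm_le: "H1_norm E u \<le> sqrt ((2 * real C + 1) * (\<integral>x. (u x)\<^sup>2 \<partial>count_space UNIV))"
proof -
  have "(\<integral>x. grad_sq E u x + (u x)\<^sup>2 \<partial>count_space UNIV)
      \<le> (\<integral>x. (\<Sum>y\<in>nbh x. (u y)\<^sup>2) + real (card (nbh x)) * (u x)\<^sup>2 + (u x)\<^sup>2 \<partial>count_space UNIV)"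
    using integrable_grad_sq integrable_sum_nbh[OF u2] integrable_deg[OF u2] u2 grad_sq_le
    by (intro integral_mono Bochner_Integration.integrable_add) auto
  also have "\<dots> = 2 * (\<integral>x. real (card (nbh x)) * (u x)\<^sup>2 \<partial>count_space UNIV) + (\<integral>x. (u x)\<^sup>2 \<partial>count_space UNIV)"
    using integrable_sum_nbh[OF u2] integrable_deg[OF u2] u2 integral_sum_nbh[OF u2] by simp
  also have "\<dots> \<le> (2 * real C + 1) * (\<integral>x. (u x)\<^sup>2 \<partial>count_space UNIV)"
    using integral_deg_le[OF u2] by (simp add: algebra_simps)
  finally show ?thesis unfolding H1_norm_def by (rule real_sqrt_le_mono)
qed

text \<open>Pointwise, \<open>u \<Delta>u + |\<nabla>u|\<^sup>2\<close> is half the difference between the sum of \<open>u\<^sup>2\<close> over the neighbours and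
  the degree times \<open>u\<^sup>2\<close>; by double counting the total of that difference is \<open>0\<close>.\<close>
lemma green_formula:
  shows "integrable (count_space UNIV) (\<lambda>x. u x * laplacian E u x)"
    and "(\<integral>x. grad_sq E u x \<partial>count_space UNIV) = - (\<integral>x. u x * laplacian E u x \<partial>count_space UNIV)"
proof -
  have eq: "u x * laplacian E u x = 1/2 * ((\<Sum>y\<in>nbh x. (u y)\<^sup>2) - real (card (nbh x)) * (u x)\<^sup>2) - grad_sq E u x" for x
  proof -
    have "u x * laplacian E u x = (\<Sum>y\<in>nbh x. u x * (u y - u x))"
      by (simp add: laplacian_def sum_distrib_left)
    also have "\<dots> = (\<Sum>y\<in>nbh x. ((u y)\<^sup>2 - (u x)\<^sup>2 - (u y - u x)\<^sup>2) / 2)"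
      by (intro sum.cong refl) (simp add: power2_eq_square field_simps)
    also have "\<dots> = ((\<Sum>y\<in>nbh x. (u y)\<^sup>2) - real (card (nbh x)) * (u x)\<^sup>2 - (\<Sum>y\<in>nbh x. (u y - u x)\<^sup>2)) / 2"
      by (simp only: sum_divide_distrib[symmetric] sum_subtractf sum_constant)
    finally show ?thesis by (simp add: grad_sq_def diff_divide_distrib)
  qed
  note ints = integrable_sum_nbh[OF u2] integrable_deg[OF u2] integrable_grad_sq
  show "integrable (count_space UNIV) (\<lambda>x. u x * laplacian E u x)"
    unfolding eq using ints by simp
  show "(\<integral>x. grad_sq E u x \<partial>count_space UNIV) = - (\<integral>x. u x * laplacian E u x \<partial>count_space UNIV)"
    unfolding eq using ints integral_sum_nbh[OF u2] by simp
qed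

text \<open>On a graph of bounded degree the gradient is bounded on \<open>\<ell>\<^sup>2\<close>, so the restrictions of a square
  summable function to an exhaustion by finite sets are Cauchy in the norm of \<open>H\<^sup>1\<close>. The tails \<open>t N\<close>
  dominate their squared differences.\<close>
lemma in_H1:
  fixes e :: "nat \<Rightarrow> 'v"
  assumes e: "bij e"
  shows "u \<in> H1 E"
proof -
  define \<phi> where "\<phi> n x = (if inv_into UNIV e x < n then u x else 0)" for n x
  have inv_e: "inv_into UNIV e (e i) = i" "e (inv_into UNIV e x) = x" for i x
    using e by (simp_all add: bij_is_inj bij_is_surj surj_f_inv_f)
  have supp: "finite {x. \<phi> n x \<noteq> 0}" for n
  proof (rule finite_subset)
    show "{x. \<phi> n x \<noteq> 0} \<subseteq> e ` {..<n}" by (auto simp: \<phi>_def image_iff split: if_splits) (metis inv_e(2) lessThan_iff)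
  qed simp
  have pt: "(\<lambda>n. \<phi> n x) \<longlonglongrightarrow> u x" for x
    by (rule tendsto_eventually) (auto simp: \<phi>_def eventually_sequentially intro!: exI[of _ "Suc (inv_into UNIV e x)"])
  define t where "t N x = (if inv_into UNIV e x < N then 0 else (u x)\<^sup>2)" for N x
  have tint: "integrable (count_space UNIV) (t N)" for N
    by (rule Bochner_Integration.integrable_bound[OF u2]) (auto simp: t_def)
  have "(\<lambda>N. \<integral>x. t N x \<partial>count_space UNIV) \<longlonglongrightarrow> (\<integral>x. 0 \<partial>count_space (UNIV :: 'v set))"
  proof (rule integral_dominated_convergence[where w = "\<lambda>x. (u x)\<^sup>2"])
    have "(\<lambda>N. t N x) \<longlonglongrightarrow> 0" for x
      by (rule tendsto_eventually)
        (auto simp: t_def eventually_sequentially intro!: exI[of _ "Suc (inv_into UNIV e x)"])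
    then show "AE x in count_space UNIV. (\<lambda>N. t N x) \<longlonglongrightarrow> 0" by simp
  qed (use u2 in \<open>auto simp: t_def\<close>)
  then have "(\<lambda>N. (2 * real C + 1) * (\<integral>x. t N x \<partial>count_space UNIV)) \<longlonglongrightarrow> 0"
    by (intro tendsto_mult_right_zero) simp
  then have tl: "(\<lambda>N. sqrt ((2 * real C + 1) * (\<integral>x. t N x \<partial>count_space UNIV))) \<longlonglongrightarrow> 0"
    using tendsto_real_sqrt by fastforce
  have cauchy: "\<exists>N. \<forall>m\<ge>N. \<forall>n\<ge>N. H1_norm E (\<lambda>x. \<phi> m x - \<phi> n x) < \<epsilon>" if \<epsilon>: "\<epsilon> > 0" for \<epsilon>
  proof -
    obtain N where N: "sqrt ((2 * real C + 1) * (\<integral>x. t N x \<partial>count_space UNIV)) < \<epsilon>"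
      using order_tendstoD(2)[OF tl \<epsilon>] by (auto simp: eventually_sequentially)
    have "H1_norm E (\<lambda>x. \<phi> m x - \<phi> n x) < \<epsilon>" if "m \<ge> N" "n \<ge> N" for m n
    proof -
      have le: "(\<phi> m x - \<phi> n x)\<^sup>2 \<le> t N x" for x using that by (auto simp: \<phi>_def t_def)
      have int: "integrable (count_space UNIV) (\<lambda>x. (\<phi> m x - \<phi> n x)\<^sup>2)"
        by (rule Bochner_Integration.integrable_bound[OF tint[of N]])
          (use le in \<open>auto intro!: AE_I2 intro: order_trans[OF _ abs_ge_self]\<close>)
      have "H1_norm E (\<lambda>x. \<phi> m x - \<phi> n x) \<le> sqrt ((2 * real C + 1) * (\<integral>x. (\<phi> m x - \<phi> n x)\<^sup>2 \<partial>count_space UNIV))"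
        by (rule bounded_degree_graph.H1_norm_le[OF bounded_degree_graph_axioms int])
      also have "\<dots> \<le> sqrt ((2 * real C + 1) * (\<integral>x. t N x \<partial>count_space UNIV))"
        using integral_mono[OF int tint le] by (intro real_sqrt_le_mono mult_left_mono) auto
      finally show ?thesis using N by linarith
    qed
    then show ?thesis by blast
  qed
  show ?thesis unfolding H1_def using supp cauchy pt by blast
qed

end

lemma ext_integral_eq:
  assumes "integrable (count_space UNIV) f"
  shows "ext_integral f = ereal (\<integral>x. f x \<partial>count_space UNIV)"
proof -
  have fin: "(\<integral>\<^sup>+x. ennreal (f x) \<partial>count_space UNIV) \<noteq> \<infinity>" "(\<integral>\<^sup>+x. ennreal (- f x) \<partial>count_space UNIV) \<noteq> \<infinity>"
    using assms by (auto simp: real_integrable_def)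
  have "enn2ereal a = ereal (enn2real a)" if "a \<noteq> \<infinity>" for a
    using that by (cases a) (auto simp: enn2ereal_ennreal)
  then show ?thesis using fin real_lebesgue_integral_def[OF assms] by (simp add: ext_integral_def)
qed

text \<open>Testing the equation with \<open>u\<close> and integrating by parts, the integrals of \<open>|\<nabla>u|\<^sup>2 + Vu\<^sup>2\<close> and
  \<open>u\<^sup>2 ln u\<^sup>2\<close> coincide; what remains of the energy is the extra \<open>u\<^sup>2/2\<close> from the weight \<open>V + 1\<close>.\<close>
lemma solution_energy:
  fixes u V :: "'v \<Rightarrow> real" and e :: "nat \<Rightarrow> 'v"
  assumes e: "bij e" and u2: "integrable (count_space UNIV) (\<lambda>x. (u x)\<^sup>2)"
    and Vu: "integrable (count_space UNIV) (\<lambda>x. (V x + 1) * (u x)\<^sup>2)"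
    and ul: "integrable (count_space UNIV) (\<lambda>x. (u x)\<^sup>2 * ln ((u x)\<^sup>2))"
    and eq: "\<And>x. - laplacian E u x + V x * u x = u x * ln ((u x)\<^sup>2)"
  shows "is_solution E V u" "J E V u = ereal ((\<integral>x. (u x)\<^sup>2 \<partial>count_space UNIV) / 2)"
proof -
  note g = integrable_grad_sq[OF u2] and gf = green_formula[OF u2]
  have "(u x)\<^sup>2 * ln ((u x)\<^sup>2) = (V x + 1) * (u x)\<^sup>2 - (u x)\<^sup>2 - u x * laplacian E u x" for x
  proof -
    have "u x * (u x * ln ((u x)\<^sup>2)) = u x * (- laplacian E u x + V x * u x)" using eq[of x] by simp
    then show ?thesis by (simp add: power2_eq_square algebra_simps)
  qed
  then have "(\<integral>x. (u x)\<^sup>2 * ln ((u x)\<^sup>2) \<partial>count_space UNIV) =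
      (\<integral>x. (V x + 1) * (u x)\<^sup>2 \<partial>count_space UNIV) - (\<integral>x. (u x)\<^sup>2 \<partial>count_space UNIV)
      + (\<integral>x. grad_sq E u x \<partial>count_space UNIV)"
    using Vu u2 gf by simp
  then show J: "J E V u = ereal ((\<integral>x. (u x)\<^sup>2 \<partial>count_space UNIV) / 2)"
    unfolding J_def using ext_integral_eq[OF ul] ext_integral_eq[OF Bochner_Integration.integrable_add[OF g Vu]] g Vu
    by (simp add: field_simps)
  show "is_solution E V u"
    unfolding is_solution_def X_space_def using in_H1[OF u2 e] Vu J eq by simp
qed

end

section \<open>Infinitely many solutions\<close>

text \<open>In an enumeration \<open>e\<close> of vertices, \<open>A\<close> is the matrix of \<open>-\<Delta> + V\<close>. Its principal
  submatrices belong to functions vanishing outside finitely many vertices, for which \<open>-\<Delta>\<close> is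
  nonnegative because \<open>2ab \<le> a\<^sup>2 + b\<^sup>2\<close>. A possible loop contributes to the degree and to the
  diagonal adjacency entry alike.\<close>
lemma graph_form_lower_bound:
  fixes E :: "('v \<times> 'v) set" and V :: "'v \<Rightarrow> real" and e :: "nat \<Rightarrow> 'v"
  assumes G: "bounded_degree_graph E C" and e: "inj e"
  defines "A \<equiv> \<lambda>i j. (if i = j then real (card {y. (e i, y) \<in> E}) + V (e i) else 0) - (if (e i, e j) \<in> E then 1 else 0)"
  shows "(\<Sum>i\<le>m. V (e i) * (w i)\<^sup>2) \<le> quad_form A m w"
proof -
  interpret bounded_degree_graph E C by (rule G)
  define d where "d i = card (nbh (e i))" for i
  define a :: "nat \<Rightarrow> nat \<Rightarrow> real" where "a i j = (if (e i, e j) \<in> E then 1 else 0)" for i j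
  have a_sym: "a i j = a j i" for i j using sym_E by (auto simp: a_def dest: symD)
  have a_sum: "(\<Sum>j\<le>m. a i j) \<le> real (d i)" for i
  proof -
    have "(\<Sum>j\<le>m. a i j) = real (card {j \<in> {..m}. (e i, e j) \<in> E})"
      by (simp add: a_def sum.If_cases Int_def)
    also have "card {j \<in> {..m}. (e i, e j) \<in> E} = card (e ` {j \<in> {..m}. (e i, e j) \<in> E})"
      using e by (simp add: card_image inj_on_def)
    also have "\<dots> \<le> d i" unfolding d_def by (intro card_mono fin) auto
    finally show ?thesis by simp
  qed
  have "2 * (\<Sum>i\<le>m. \<Sum>j\<le>m. a i j * (w i * w j)) = (\<Sum>i\<le>m. \<Sum>j\<le>m. a i j * (2 * w i * w j))"
    by (simp add: sum_distrib_left mult_ac)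
  also have "\<dots> \<le> (\<Sum>i\<le>m. \<Sum>j\<le>m. a i j * ((w i)\<^sup>2 + (w j)\<^sup>2))"
    by (intro sum_mono mult_left_mono sum_squares_bound) (simp add: a_def)
  also have "\<dots> = (\<Sum>i\<le>m. \<Sum>j\<le>m. a i j * (w i)\<^sup>2) + (\<Sum>i\<le>m. \<Sum>j\<le>m. a j i * (w j)\<^sup>2)"
    by (simp add: ring_distribs sum.distrib a_sym)
  also have "(\<Sum>i\<le>m. \<Sum>j\<le>m. a j i * (w j)\<^sup>2) = (\<Sum>i\<le>m. \<Sum>j\<le>m. a i j * (w i)\<^sup>2)"
    by (rule sum.swap)
  also have "(\<Sum>i\<le>m. \<Sum>j\<le>m. a i j * (w i)\<^sup>2) = (\<Sum>i\<le>m. (\<Sum>j\<le>m. a i j) * (w i)\<^sup>2)"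
    by (simp add: sum_distrib_right)
  also have "\<dots> \<le> (\<Sum>i\<le>m. real (d i) * (w i)\<^sup>2)"
    by (intro sum_mono mult_right_mono a_sum) auto
  finally have le: "(\<Sum>i\<le>m. \<Sum>j\<le>m. a i j * (w i * w j)) \<le> (\<Sum>i\<le>m. real (d i) * (w i)\<^sup>2)"
    using a_sum by simp
  have "quad_form A m w = (\<Sum>i\<le>m. \<Sum>j\<le>m. (if i = j then (real (d i) + V (e i)) * (w i * w j) else 0) - a i j * (w i * w j))"
    unfolding quad_form_def by (intro sum.cong refl) (simp add: A_def a_def d_def algebra_simps)
  also have "\<dots> = (\<Sum>i\<le>m. (real (d i) + V (e i)) * (w i)\<^sup>2) - (\<Sum>i\<le>m. \<Sum>j\<le>m. a i j * (w i * w j))"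
    by (simp add: sum_subtractf power2_eq_square)
  finally show ?thesis using le by (simp add: ring_distribs sum.distrib)
qed

text \<open>Scaling the eigenvector by \<open>\<sigma> = \<plusminus>exp(\<lambda>/2)\<close> absorbs the multiplier: \<open>ln (\<sigma>w)\<^sup>2 = \<lambda> + ln w\<^sup>2\<close>. The energy
  is \<open>exp(\<lambda>)/2 \<ge> \<lambda>/2\<close>, so \<open>\<lambda> \<ge> 2K\<close> is what has to be asked for.\<close>
lemma solution_of_large_energy:
  fixes E :: "('v \<times> 'v) set" and V :: "'v \<Rightarrow> real" and x0 :: 'v and K :: real
  assumes inf: "infinite (UNIV :: 'v set)" and sym: "sym E" and con: "graph_connected E"
    and ulf: "uniformly_locally_finite E" and V1: "(INF x. ereal (V x)) > -1"
    and Vlim: "filterlim V at_top (filtercomap (\<lambda>x. gdist E x x0) at_top)"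
  obtains u a where "is_solution E V u" "is_solution E V (\<lambda>x. - u x)"
    "J E V u = ereal a" "J E V (\<lambda>x. - u x) = ereal a" "K \<le> a"
proof -
  obtain C where C: "\<And>x. finite {y. (x, y) \<in> E}" "\<And>x. card {y. (x, y) \<in> E} \<le> C"
    using ulf unfolding uniformly_locally_finite_def by blast
  interpret bounded_degree_graph E C by standard (use sym C in auto)
  have Vgt: "- 1 \<le> V x" for x
  proof -
    have "- 1 < ereal (V x)" using V1 INF_lower[of x UNIV "\<lambda>x. ereal (V x)"] by (simp add: less_le_trans)
    then show ?thesis by (simp add: one_ereal_def)
  qed
  define e :: "nat \<Rightarrow> 'v" where "e = from_nat_into UNIV"
  have e: "bij e" unfolding e_def by (rule bij_betw_from_nat_into[OF countable_vertices[OF con] inf])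
  have inj: "inj e" using e by (rule bij_is_inj)
  have e_eq: "e i = e j \<longleftrightarrow> i = j" for i j using inj by (simp add: inj_eq)
  have inv_e: "inv_into UNIV e (e i) = i" for i using inj by simp
  have ve: "filterlim (\<lambda>i. V (e i)) at_top sequentially"
    unfolding filterlim_at_top_dense
  proof
    fix Z
    have "finite (e -` {x. V x \<le> Z})" by (intro finite_vimageI finite_sublevel[OF con Vlim] inj)
    then have "finite {i. \<not> Z < V (e i)}" by (simp add: vimage_def not_less)
    then show "eventually (\<lambda>i. Z < V (e i)) sequentially"
      by (simp add: cofinite_eq_sequentially[symmetric] eventually_cofinite)
  qed
  define A where "A = (\<lambda>i j. (if i = j then real (card (nbh (e i))) + V (e i) else 0) - (if (e i, e j) \<in> E then 1 else 0))"
  have Asym: "A i j = A j i" for i j using sym by (auto simp: A_def dest: symD)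
  have Asub: "{j. A i j \<noteq> 0} \<subseteq> insert i (e -` nbh (e i))" for i by (auto simp: A_def split: if_splits)
  have Afin: "finite (insert i (e -` nbh (e i)))" for i
    using finite_vimageI[OF fin[of "e i"] inj] by (rule finite.insertI)
  have low: "(\<Sum>i\<le>m. V (e i) * (w i)\<^sup>2) \<le> quad_form A m w" for m w
    unfolding A_def by (rule graph_form_lower_bound[OF bounded_degree_graph_axioms inj])
  obtain w lam where lam: "2 * K \<le> lam" and w1: "(\<lambda>i. (w i)\<^sup>2) sums 1"
    and wv: "summable (\<lambda>i. (V (e i) + 1) * (w i)\<^sup>2)" and wl: "summable (\<lambda>i. (w i)\<^sup>2 * ln ((w i)\<^sup>2))"
    and weq: "\<And>i. (\<Sum>j | A i j \<noteq> 0. A i j * w j) = w i * ln ((w i)\<^sup>2) + lam * w i"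
    using log_nonlinear_eigenvector[of A "\<lambda>i. V (e i)" "2 * K", OF Asym finite_subset[OF Asub Afin] low Vgt ve]
    by blast
  have Lap: "- laplacian E (\<lambda>x. w (inv_into UNIV e x)) (e i) + V (e i) * w i = w i * ln ((w i)\<^sup>2) + lam * w i" for i
  proof -
    have im: "nbh (e i) = e ` (e -` nbh (e i))" 
      by (rule surj_image_vimage_eq[OF bij_is_surj[OF e], symmetric])
    have "(\<Sum>j | A i j \<noteq> 0. A i j * w j) = (\<Sum>j\<in>insert i (e -` nbh (e i)). A i j * w j)"
      by (rule sum.mono_neutral_left[OF Afin Asub]) auto
    also have "\<dots> = (\<Sum>j\<in>insert i (e -` nbh (e i)). (if i = j then (real (card (nbh (e i))) + V (e i)) * w i else 0)
        - (if (e i, e j) \<in> E then w j else 0))"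
      by (intro sum.cong refl) (auto simp: A_def algebra_simps)
    also have "\<dots> = (real (card (nbh (e i))) + V (e i)) * w i - (\<Sum>j\<in>insert i (e -` nbh (e i)). if (e i, e j) \<in> E then w j else 0)"
      using Afin[of i] by (simp only: sum_subtractf) (simp add: sum.delta)
    also have "(\<Sum>j\<in>insert i (e -` nbh (e i)). if (e i, e j) \<in> E then w j else 0) = (\<Sum>j\<in>e -` nbh (e i). w j)"
      using Afin[of i] by (intro sum.mono_neutral_cong_right) auto
    also have "\<dots> = (\<Sum>y\<in>nbh (e i). w (inv_into UNIV e y))"
      by (subst im, subst sum.reindex) (auto simp: inv_e inj_on_def e_eq)
    finally show ?thesis using weq[of i]
      by (simp add: laplacian_def sum_subtractf inv_e algebra_simps)
  qed
  define s where "s = exp (lam / 2)"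
  have s2: "s\<^sup>2 = exp lam" by (simp add: s_def flip: exp_double)
  have main: "is_solution E V (\<lambda>x. \<sigma> * w (inv_into UNIV e x)) \<and>
      J E V (\<lambda>x. \<sigma> * w (inv_into UNIV e x)) = ereal (exp lam / 2)" if \<sigma>: "\<sigma>\<^sup>2 = exp lam" for \<sigma>
  proof -
    let ?u = "\<lambda>x. \<sigma> * w (inv_into UNIV e x)"
    have \<sigma>0: "\<sigma> \<noteq> 0" using \<sigma> by auto
    have u2: "(?u (e i))\<^sup>2 = exp lam * (w i)\<^sup>2" for i by (simp add: inv_e power_mult_distrib \<sigma>)
    have ln_u: "w i * ln ((?u (e i))\<^sup>2) = w i * (lam + ln ((w i)\<^sup>2))" for i
      by (cases "w i = 0") (simp_all add: u2 ln_mult)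
    have bij: "integrable (count_space UNIV) f" if "integrable (count_space UNIV) (\<lambda>i. f (e i))" for f :: "'v \<Rightarrow> real"
      using that integrable_bij_count_space[OF e, of f] by simp
    have iw: "integrable (count_space UNIV) (\<lambda>i. (w i)\<^sup>2)"
      using sums_summable[OF w1] by (simp add: integrable_count_space_nat_iff)
    have iwl: "integrable (count_space UNIV) (\<lambda>i. (w i)\<^sup>2 * ln ((w i)\<^sup>2))"
    proof -
      have "(w i)\<^sup>2 \<le> 1" for i
        using sum_le_suminf[OF sums_summable[OF w1], of "{i}"] sums_unique[OF w1] by simp
      then have "(w i)\<^sup>2 * ln ((w i)\<^sup>2) \<le> 0" for i
        by (cases "w i = 0") (auto intro!: mult_nonneg_nonpos)
      then have "norm ((w i)\<^sup>2 * ln ((w i)\<^sup>2)) = - ((w i)\<^sup>2 * ln ((w i)\<^sup>2))" for i by simp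
      then show ?thesis using summable_minus[OF wl] unfolding integrable_count_space_nat_iff by simp
    qed
    have iwv: "integrable (count_space UNIV) (\<lambda>i. (V (e i) + 1) * (w i)\<^sup>2)"
    proof -
      have "norm ((V (e i) + 1) * (w i)\<^sup>2) = (V (e i) + 1) * (w i)\<^sup>2" for i using Vgt[of "e i"] by simp
      then show ?thesis using wv unfolding integrable_count_space_nat_iff by simp
    qed
    have U2: "integrable (count_space UNIV) (\<lambda>x. (?u x)\<^sup>2)"
      by (rule bij) (simp only: u2, simp add: iw)
    have UV: "integrable (count_space UNIV) (\<lambda>x. (V x + 1) * (?u x)\<^sup>2)"
    proof (rule bij)
      have "(V (e i) + 1) * (?u (e i))\<^sup>2 = exp lam * ((V (e i) + 1) * (w i)\<^sup>2)" for i by (simp only: u2 mult_ac)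
      then show "integrable (count_space UNIV) (\<lambda>i. (V (e i) + 1) * (?u (e i))\<^sup>2)"
        by (simp only:) (intro integrable_mult_right iwv)
    qed
    have UL: "integrable (count_space UNIV) (\<lambda>x. (?u x)\<^sup>2 * ln ((?u x)\<^sup>2))"
    proof (rule bij)
      have "(?u (e i))\<^sup>2 * ln ((?u (e i))\<^sup>2) = exp lam * (lam * (w i)\<^sup>2 + (w i)\<^sup>2 * ln ((w i)\<^sup>2))" for i
      proof -
        have "(?u (e i))\<^sup>2 * L = exp lam * w i * (w i * L)" for L
          unfolding u2 by (simp add: power2_eq_square)
        then have "(?u (e i))\<^sup>2 * ln ((?u (e i))\<^sup>2) = exp lam * w i * (w i * ln ((?u (e i))\<^sup>2))" .
        then show ?thesis unfolding ln_u by (simp add: power2_eq_square algebra_simps)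
      qed
      then show "integrable (count_space UNIV) (\<lambda>i. (?u (e i))\<^sup>2 * ln ((?u (e i))\<^sup>2))"
        by (simp only:) (intro integrable_mult_right Bochner_Integration.integrable_add iw iwl)
    qed
    have eq: "- laplacian E ?u x + V x * ?u x = ?u x * ln ((?u x)\<^sup>2)" for x
    proof -
      obtain i where x: "x = e i" using e by (metis bij_pointE)
      have "laplacian E ?u x = \<sigma> * laplacian E (\<lambda>x. w (inv_into UNIV e x)) x"
        by (simp add: laplacian_def sum_distrib_left right_diff_distrib)
      then have "- laplacian E ?u x + V x * ?u x
          = \<sigma> * (- laplacian E (\<lambda>x. w (inv_into UNIV e x)) (e i) + V (e i) * w i)"
        by (simp add: x inv_e algebra_simps)
      also have "\<dots> = \<sigma> * (w i * ln ((w i)\<^sup>2) + lam * w i)" by (simp only: Lap)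
      also have "\<dots> = \<sigma> * (w i * ln ((?u x)\<^sup>2))" unfolding x ln_u by (simp add: algebra_simps)
      finally show ?thesis by (simp add: x inv_e)
    qed
    have "(\<integral>x. (?u x)\<^sup>2 \<partial>count_space UNIV) = (\<integral>i. (?u (e i))\<^sup>2 \<partial>count_space UNIV)"
      by (rule integral_bij_count_space[OF e, symmetric])
    also have "\<dots> = exp lam * (\<integral>i. (w i)\<^sup>2 \<partial>count_space UNIV)" by (simp only: u2) simp
    also have "(\<integral>i. (w i)\<^sup>2 \<partial>count_space UNIV) = 1"
      using integral_count_space_nat[OF iw] sums_unique[OF w1] by simp
    finally have "(\<integral>x. (?u x)\<^sup>2 \<partial>count_space UNIV) = exp lam" by simp
    then show ?thesis using solution_energy[OF e U2 UV UL eq] by simp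
  qed
  have "K \<le> exp lam / 2" using lam exp_ge_add_one_self[of lam] by linarith
  moreover have "(- s)\<^sup>2 = exp lam" using s2 by simp
  ultimately show thesis
    using that[of "\<lambda>x. s * w (inv_into UNIV e x)" "exp lam / 2"] main[OF s2] main[of "- s"] by simp
qed

text \<open>Pick solutions of strictly increasing and unbounded energy; \<open>J\<close> takes the same value at
  \<open>u\<close> and \<open>-u\<close>, so different energies also separate the pairs.\<close>
theorem theorem1p1:
  fixes E :: "('v \<times> 'v) set" and V :: "'v \<Rightarrow> real" and x\<^sub>0 :: 'v
  assumes "infinite (UNIV :: 'v set)"
    and "sym E"
    and "graph_connected E"
    and "uniformly_locally_finite E"
    and "(INF x. ereal (V x)) > -1"
    and "filterlim V at_top (filtercomap (\<lambda>x. gdist E x x\<^sub>0) at_top)"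
  shows "\<exists>u :: nat \<Rightarrow> 'v \<Rightarrow> real.
    (\<forall>n. is_solution E V (u n) \<and> is_solution E V (\<lambda>x. - u n x)) \<and>
    (\<forall>m n. m \<noteq> n \<longrightarrow> u m \<noteq> u n \<and> u m \<noteq> (\<lambda>x. - u n x)) \<and>
    ((\<lambda>n. J E V (u n)) \<longlonglongrightarrow> \<infinity>) \<and>
    ((\<lambda>n. J E V (\<lambda>x. - u n x)) \<longlonglongrightarrow> \<infinity>)"
proof -
  define P where "P u a \<longleftrightarrow> is_solution E V u \<and> is_solution E V (\<lambda>x. - u x) \<and>
    J E V u = ereal a \<and> J E V (\<lambda>x. - u x) = ereal a" for u a
  have ex: "\<exists>p. P (fst p) (snd p) \<and> K \<le> snd p" for K
  proof -
    obtain u a where "is_solution E V u" "is_solution E V (\<lambda>x. - u x)"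
      "J E V u = ereal a" "J E V (\<lambda>x. - u x) = ereal a" "K \<le> a"
      using solution_of_large_energy[OF assms] by metis
    then show ?thesis by (intro exI[of _ "(u, a)"]) (simp add: P_def)
  qed
  have "\<exists>f. \<forall>n. (P (fst (f n)) (snd (f n)) \<and> real n \<le> snd (f n)) \<and> snd (f n) < snd (f (Suc n))"
  proof (rule dependent_nat_choice)
    show "\<exists>p. P (fst p) (snd p) \<and> real 0 \<le> snd p" using ex[of "real 0"] .
    fix p n
    obtain q where q: "P (fst q) (snd q) \<and> max (real (Suc n)) (snd p + 1) \<le> snd q" using ex by blast
    then show "\<exists>q. (P (fst q) (snd q) \<and> real (Suc n) \<le> snd q) \<and> snd p < snd q"
      by (intro exI[of _ q]) auto
  qed
  then obtain f where f: "\<And>n. P (fst (f n)) (snd (f n))" "\<And>n. real n \<le> snd (f n)"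
    and f_less: "\<And>n. snd (f n) < snd (f (Suc n))" by blast
  define u where "u n = fst (f n)" for n
  define a where "a n = snd (f n)" for n
  have sol: "is_solution E V (u n) \<and> is_solution E V (\<lambda>x. - u n x)"
    and J1: "J E V (u n) = ereal (a n)" and J2: "J E V (\<lambda>x. - u n x) = ereal (a n)" for n
    using f(1)[of n] by (auto simp: P_def u_def a_def)
  have "strict_mono a" using f_less by (simp add: strict_mono_Suc_iff a_def)
  then have a_neq: "a m \<noteq> a n" if "m \<noteq> n" for m n
    using that by (simp add: strict_mono_eq)
  have distinct: "u m \<noteq> u n \<and> u m \<noteq> (\<lambda>x. - u n x)" if "m \<noteq> n" for m n
    using a_neq[OF that] J1[of m] J1[of n] J2[of n] by auto
  have "(\<lambda>n. ereal (a n)) \<longlonglongrightarrow> \<infinity>"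
    unfolding tendsto_PInfty
  proof
    fix r :: real
    obtain N :: nat where N: "r < real N" using reals_Archimedean2 by blast
    have "ereal r < ereal (a n)" if "n \<ge> N" for n
      using N f(2)[of n] that by (simp add: a_def)
    then show "eventually (\<lambda>n. ereal r < ereal (a n)) sequentially"
      unfolding eventually_sequentially by blast
  qed
  then show ?thesis using sol distinct J1 J2 by (intro exI[of _ u]) simp
qed

end
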